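(* Let $\mathcal{A}$ be an Arens regular Banach algebra with a bounded approximate identity, which is a right ideal of $\mathcal{A}^{**}$. Suppose that for every neo-unital Banach $\mathcal{A}^{**}$-module $X$, $X^*$ factors $\mathcal{A}$ on the left, i.e. $\mathcal{A}X^*=X^*$. If $\mathcal{A}^{**}$ is Connes amenable, then $\mathcal{A}$ is amenable.
   Context: For a Banach algebra $\mathcal{A}$, the second dual $\mathcal{A}^{**}$ is a Banach algebra under the first Arens product, $a''b''=w^*\text{-}\lim_i\lim_j a_ib_j$ whenever $(a_i),(b_j)$ are bounded nets in $\mathcal{A}$ with $a_i\to a''$, $b_j\to b''$ weak$^*$; $\mathcal{A}$ is regarded as a subalgebra of $\mathcal{A}^{**}$ via the canonical embedding. $\mathcal{A}$ is Arens regular if its two Arens products on $\mathcal{A}^{**}$ coincide; then $\mathcal{A}^{**}$ is a dual Banach algebra with predual $\mathcal{A}^*$. $\mathcal{A}$ is a right ideal of $\mathcal{A}^{**}$ if $aa''\in\mathcal{A}$ for all $a\in\mathcal{A}$, $a''\in\mathcal{A}^{**}$. "Module" means Banach bimodule. A Banach $\mathcal{A}^{**}$-module $X$ is neo-unital if $X=\mathcal{A}^{**}X\mathcal{A}^{**}=\{a''\cdot x\cdot b'': a'',b''\in\mathcal{A}^{**},x\in X\}$. The dual $X^*$ carries the dual module actions, and $\mathcal{A}X^*=\{a\cdot f: a\in\mathcal{A}, f\in X^*\}$. A Banach algebra $\mathcal{B}$ is dual if there is a closed submodule $\mathcal{B}_*$ of $\mathcal{B}^*$ with $\mathcal{B}=(\mathcal{B}_*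 )^*$. A dual Banach $\mathcal{B}$-module $X$ (i.e. $X$ is the dual of a Banach $\mathcal{B}$-module, with the dual actions) over a dual Banach algebra $\mathcal{B}$ is normal if for every $x\in X$ the maps $a\mapsto a\cdot x$ and $a\mapsto x\cdot a$ are weak$^*$-weak$^*$-continuous from $\mathcal{B}$ to $X$. A derivation $D:\mathcal{B}\to X$ is a linear map with $D(ab)=D(a)\cdot b+a\cdot D(b)$; it is inner if $D(a)=a\cdot x-x\cdot a$ for some $x\in X$ and all $a$. A dual Banach algebra $\mathcal{B}$ is Connes amenable if every weak$^*$-weak$^*$-continuous derivation from $\mathcal{B}$ into every normal dual Banach $\mathcal{B}$-module is inner. A Banach algebra $\mathcal{B}$ is amenable if for every Banach $\mathcal{B}$-module $X$ every bounded derivation from $\mathcal{B}$ into $X^*$ is inner. *)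

theory Defs
  imports "HOL-Analysis.Analysis" "HOL-Algebra.Module"
begin

text \<open>
  Banach spaces, algebras and modules are records with explicit carriers, because the statement
  quantifies over all Banach modules (with all their norms) inside hypotheses.
  The scalar field is the field of complex numbers. The \<open>mult\<close> field of the record is
  the product when the record represents an algebra and is ignored otherwise; the \<open>one\<close>
  field is always ignored (algebras need not be unital).
\<close>

section \<open>Banach spaces and Banach algebras\<close>

definition complex_field :: "complex ring" where
  "complex_field = \<lparr>carrier = UNIV, monoid.mult = (*), one = 1, ring.zero = 0, add = (+)\<rparr>"

lemma cring_complex_field: "cring complex_field"
proof -
  have "\<exists>y. x + y = 0" for x :: complex
    using add.right_inverse by blast
  then show ?thesis
    unfolding complex_field_def using add.right_inverse
    by unfold_locales (auto simp: algebra_simps Units_def)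
qed

record 'v normed_space = "(complex, 'v) module" +
  nrm :: "'v \<Rightarrow> real"

locale complex_normed_space =
  module complex_field V
    for V :: "('v, 'm) normed_space_scheme" (structure) +
  assumes nrm_eq_0_iff: "x \<in> carrier V \<Longrightarrow> nrm V x = 0 \<longleftrightarrow> x = \<zero>"
    and nrm_triangle: "\<lbrakk>x \<in> carrier V; y \<in> carrier V\<rbrakk> \<Longrightarrow> nrm V (x \<oplus> y) \<le> nrm V x + nrm V y"
    and nrm_smult: "x \<in> carrier V \<Longrightarrow> nrm V (c \<odot> x) = cmod c * nrm V x"

locale banach_space = complex_normed_space +
  assumes complete:
    "\<lbrakk>\<And>n. s n \<in> carrier V; \<And>e. e > 0 \<Longrightarrow> \<exists>N. \<forall>m\<ge>N. \<forall>n\<ge>N. nrm V (s m \<ominus> s n) < e\<rbrakk>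
      \<Longrightarrow> \<exists>l\<in>carrier V. (\<lambda>n::nat. nrm V (s n \<ominus> l)) \<longlonglongrightarrow> 0"

locale banach_algebra = banach_space A for A (structure) +
  assumes mult_closed: "\<lbrakk>a \<in> carrier A; b \<in> carrier A\<rbrakk> \<Longrightarrow> a \<otimes> b \<in> carrier A"
    and mult_assoc:
      "\<lbrakk>a \<in> carrier A; b \<in> carrier A; c \<in> carrier A\<rbrakk> \<Longrightarrow> (a \<otimes> b) \<otimes> c = a \<otimes> (b \<otimes> c)"
    and mult_add_left:
      "\<lbrakk>a \<in> carrier A; b \<in> carrier A; c \<in> carrier A\<rbrakk> \<Longrightarrow> (a \<oplus> b) \<otimes> c = a \<otimes> c \<oplus> b \<otimes> c"
    and mult_add_right:
      "\<lbrakk>a \<in> carrier A; b \<in> carrier A; c \<in> carrier A\<rbrakk> \<Longrightarrow> a \<otimes> (b \<oplus> c) = a \<otimes> b \<oplus> a \<otimes> c"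
    and mult_smult_left:
      "\<lbrakk>a \<in> carrier A; b \<in> carrier A\<rbrakk> \<Longrightarrow> (z \<odot> a) \<otimes> b = z \<odot> (a \<otimes> b)"
    and mult_smult_right:
      "\<lbrakk>a \<in> carrier A; b \<in> carrier A\<rbrakk> \<Longrightarrow> a \<otimes> (z \<odot> b) = z \<odot> (a \<otimes> b)"
    and nrm_mult: "\<lbrakk>a \<in> carrier A; b \<in> carrier A\<rbrakk> \<Longrightarrow> nrm A (a \<otimes> b) \<le> nrm A a * nrm A b"

text \<open>A bounded net is rendered as a proper filter concentrated on a norm-bounded set.\<close>

definition has_bounded_approximate_identity :: "('a, 'm) normed_space_scheme \<Rightarrow> bool" where
  "has_bounded_approximate_identity A \<longleftrightarrow>
    (\<exists>F K. F \<noteq> bot \<and> (\<forall>\<^sub>F e in F. e \<in> carrier A \<and> nrm A e \<le> K) \<and>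
      (\<forall>a\<in>carrier A.
        ((\<lambda>e. nrm A (e \<otimes>\<^bsub>A\<^esub> a \<ominus>\<^bsub>A\<^esub> a)) \<longlongrightarrow> 0) F \<and>
        ((\<lambda>e. nrm A (a \<otimes>\<^bsub>A\<^esub> e \<ominus>\<^bsub>A\<^esub> a)) \<longlongrightarrow> 0) F))"


section \<open>Dual spaces and weak* topologies\<close>

text \<open>Functionals are extensional, i.e. \<open>undefined\<close> off the carrier, so that equality of
  functionals is equality of HOL functions.\<close>

definition functionals :: "('v, 'm) normed_space_scheme \<Rightarrow> ('v \<Rightarrow> complex) set" where
  "functionals V = {f \<in> extensional (carrier V).
      (\<forall>x\<in>carrier V. \<forall>y\<in>carrier V. f (x \<oplus>\<^bsub>V\<^esub> y) = f x + f y) \<and>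
      (\<forall>c. \<forall>x\<in>carrier V. f (c \<odot>\<^bsub>V\<^esub> x) = c * f x) \<and>
      (\<exists>K. \<forall>x\<in>carrier V. cmod (f x) \<le> K * nrm V x)}"

definition dual :: "('v, 'm) normed_space_scheme \<Rightarrow> ('v \<Rightarrow> complex) normed_space" where
  "dual V = \<lparr>carrier = functionals V, monoid.mult = undefined, one = undefined,
    ring.zero = (\<lambda>x\<in>carrier V. 0), add = (\<lambda>f g. \<lambda>x\<in>carrier V. f x + g x),
    smult = (\<lambda>c f. \<lambda>x\<in>carrier V. c * f x),
    nrm = (\<lambda>f. SUP x\<in>{x \<in> carrier V. nrm V x \<le> 1}. cmod (f x))\<rparr>"

definition embed :: "('v, 'm) normed_space_scheme \<Rightarrow> 'v \<Rightarrow> ('v \<Rightarrow> complex) \<Rightarrow> complex" where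
  "embed V x = (\<lambda>f\<in>carrier (dual V). f x)"

text \<open>The weak* topology \<open>\<sigma>(V*, V)\<close> on the carrier of \<open>dual V\<close>.\<close>

definition weakstar :: "('v, 'm) normed_space_scheme \<Rightarrow> ('v \<Rightarrow> complex) topology" where
  "weakstar V = subtopology (product_topology (\<lambda>_. euclidean) (carrier V)) (carrier (dual V))"


section \<open>Arens products\<close>

text \<open>
  For \<open>f\<close> in \<open>A*\<close>, \<open>p\<close> in \<open>A**\<close>: \<open>(f.a)(b) = f(ab)\<close>, \<open>(p.f)(a) = p(f.a)\<close> and dually
  \<open>(a.f)(b) = f(ba)\<close>, \<open>(f.p)(a) = p(a.f)\<close>; the first Arens product is \<open>(pq)(f) = p(q.f)\<close>, the
  second one \<open>(pq)(f) = q(f.p)\<close>. The lemmas \<open>arens1_iterated_limit\<close> and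
  \<open>arens2_iterated_limit\<close> below show that they are the iterated limits of
  weak* convergent nets (here along filters).
\<close>

definition functional_left :: "('a, 'm) normed_space_scheme \<Rightarrow>
    (('a \<Rightarrow> complex) \<Rightarrow> complex) \<Rightarrow> ('a \<Rightarrow> complex) \<Rightarrow> 'a \<Rightarrow> complex" where
  "functional_left A p f = (\<lambda>a\<in>carrier A. p (\<lambda>b\<in>carrier A. f (a \<otimes>\<^bsub>A\<^esub> b)))"

definition functional_right :: "('a, 'm) normed_space_scheme \<Rightarrow>
    ('a \<Rightarrow> complex) \<Rightarrow> (('a \<Rightarrow> complex) \<Rightarrow> complex) \<Rightarrow> 'a \<Rightarrow> complex" where
  "functional_right A f p = (\<lambda>a\<in>carrier A. p (\<lambda>b\<in>carrier A. f (b \<otimes>\<^bsub>A\<^esub> a)))"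

definition arens1 :: "('a, 'm) normed_space_scheme \<Rightarrow> (('a \<Rightarrow> complex) \<Rightarrow> complex) \<Rightarrow>
    (('a \<Rightarrow> complex) \<Rightarrow> complex) \<Rightarrow> ('a \<Rightarrow> complex) \<Rightarrow> complex" where
  "arens1 A p q = (\<lambda>f\<in>carrier (dual A). p (functional_left A q f))"

definition arens2 :: "('a, 'm) normed_space_scheme \<Rightarrow> (('a \<Rightarrow> complex) \<Rightarrow> complex) \<Rightarrow>
    (('a \<Rightarrow> complex) \<Rightarrow> complex) \<Rightarrow> ('a \<Rightarrow> complex) \<Rightarrow> complex" where
  "arens2 A p q = (\<lambda>f\<in>carrier (dual A). q (functional_right A f p))"

definition bidual :: "('a, 'm) normed_space_scheme \<Rightarrow> (('a \<Rightarrow> complex) \<Rightarrow> complex) normed_space" where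
  "bidual A = (dual (dual A))\<lparr>monoid.mult := arens1 A\<rparr>"

definition arens_regular :: "('a, 'm) normed_space_scheme \<Rightarrow> bool" where
  "arens_regular A \<longleftrightarrow>
    (\<forall>p\<in>carrier (bidual A). \<forall>q\<in>carrier (bidual A). arens1 A p q = arens2 A p q)"

definition right_ideal_of_bidual :: "('a, 'm) normed_space_scheme \<Rightarrow> bool" where
  "right_ideal_of_bidual A \<longleftrightarrow>
    (\<forall>a\<in>carrier A. \<forall>p\<in>carrier (bidual A). embed A a \<otimes>\<^bsub>bidual A\<^esub> p \<in> embed A ` carrier A)"


section \<open>Banach bimodules\<close>

record ('b, 'v) bimodule = "'v normed_space" +
  lact :: "'b \<Rightarrow> 'v \<Rightarrow> 'v"
  ract :: "'v \<Rightarrow> 'b \<Rightarrow> 'v"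

locale banach_bimodule = B: banach_algebra B + X: banach_space X
  for B :: "('b, 'm) normed_space_scheme" and X :: "('b, 'v, 'n) bimodule_scheme" +
  assumes lact_closed: "\<lbrakk>a \<in> carrier B; x \<in> carrier X\<rbrakk> \<Longrightarrow> lact X a x \<in> carrier X"
    and ract_closed: "\<lbrakk>a \<in> carrier B; x \<in> carrier X\<rbrakk> \<Longrightarrow> ract X x a \<in> carrier X"
    and lact_add_left: "\<lbrakk>a \<in> carrier B; b \<in> carrier B; x \<in> carrier X\<rbrakk>
      \<Longrightarrow> lact X (a \<oplus>\<^bsub>B\<^esub> b) x = lact X a x \<oplus>\<^bsub>X\<^esub> lact X b x"
    and lact_add_right: "\<lbrakk>a \<in> carrier B; x \<in> carrier X; y \<in> carrier X\<rbrakk>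
      \<Longrightarrow> lact X a (x \<oplus>\<^bsub>X\<^esub> y) = lact X a x \<oplus>\<^bsub>X\<^esub> lact X a y"
    and lact_smult_left: "\<lbrakk>a \<in> carrier B; x \<in> carrier X\<rbrakk>
      \<Longrightarrow> lact X (c \<odot>\<^bsub>B\<^esub> a) x = c \<odot>\<^bsub>X\<^esub> lact X a x"
    and lact_smult_right: "\<lbrakk>a \<in> carrier B; x \<in> carrier X\<rbrakk>
      \<Longrightarrow> lact X a (c \<odot>\<^bsub>X\<^esub> x) = c \<odot>\<^bsub>X\<^esub> lact X a x"
    and ract_add_left: "\<lbrakk>a \<in> carrier B; x \<in> carrier X; y \<in> carrier X\<rbrakk>
      \<Longrightarrow> ract X (x \<oplus>\<^bsub>X\<^esub> y) a = ract X x a \<oplus>\<^bsub>X\<^esub> ract X y a"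
    and ract_add_right: "\<lbrakk>a \<in> carrier B; b \<in> carrier B; x \<in> carrier X\<rbrakk>
      \<Longrightarrow> ract X x (a \<oplus>\<^bsub>B\<^esub> b) = ract X x a \<oplus>\<^bsub>X\<^esub> ract X x b"
    and ract_smult_left: "\<lbrakk>a \<in> carrier B; x \<in> carrier X\<rbrakk>
      \<Longrightarrow> ract X (c \<odot>\<^bsub>X\<^esub> x) a = c \<odot>\<^bsub>X\<^esub> ract X x a"
    and ract_smult_right: "\<lbrakk>a \<in> carrier B; x \<in> carrier X\<rbrakk>
      \<Longrightarrow> ract X x (c \<odot>\<^bsub>B\<^esub> a) = c \<odot>\<^bsub>X\<^esub> ract X x a"
    and lact_mult: "\<lbrakk>a \<in> carrier B; b \<in> carrier B; x \<in> carrier X\<rbrakk>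
      \<Longrightarrow> lact X (a \<otimes>\<^bsub>B\<^esub> b) x = lact X a (lact X b x)"
    and ract_mult: "\<lbrakk>a \<in> carrier B; b \<in> carrier B; x \<in> carrier X\<rbrakk>
      \<Longrightarrow> ract X x (a \<otimes>\<^bsub>B\<^esub> b) = ract X (ract X x a) b"
    and lact_ract: "\<lbrakk>a \<in> carrier B; b \<in> carrier B; x \<in> carrier X\<rbrakk>
      \<Longrightarrow> ract X (lact X a x) b = lact X a (ract X x b)"
    and lact_bounded:
      "\<exists>K. \<forall>a\<in>carrier B. \<forall>x\<in>carrier X. nrm X (lact X a x) \<le> K * nrm B a * nrm X x"
    and ract_bounded:
      "\<exists>K. \<forall>a\<in>carrier B. \<forall>x\<in>carrier X. nrm X (ract X x a) \<le> K * nrm B a * nrm X x"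

text \<open>The dual module: \<open>(a.f)(x) = f(x.a)\<close> and \<open>(f.a)(x) = f(a.x)\<close>.\<close>

definition dual_module :: "('b, 'v, 'm) bimodule_scheme \<Rightarrow> ('b, 'v \<Rightarrow> complex) bimodule" where
  "dual_module X = normed_space.extend (dual X)
     (bimodule.fields (\<lambda>a f. \<lambda>x\<in>carrier X. f (ract X x a)) (\<lambda>f a. \<lambda>x\<in>carrier X. f (lact X a x)))"

definition neo_unital :: "('b, 'm) normed_space_scheme \<Rightarrow> ('b, 'v, 'n) bimodule_scheme \<Rightarrow> bool" where
  "neo_unital B X \<longleftrightarrow>
    carrier X = {lact X a (ract X x b) |a x b. a \<in> carrier B \<and> x \<in> carrier X \<and> b \<in> carrier B}"

text \<open>For a module \<open>X\<close> over the bidual of \<open>A\<close>: the set \<open>A X*\<close> of products is all of \<open>X*\<close>.\<close>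

definition dual_factors_on_left ::
  "('a, 'm) normed_space_scheme \<Rightarrow> (('a \<Rightarrow> complex) \<Rightarrow> complex, 'v, 'n) bimodule_scheme \<Rightarrow> bool" where
  "dual_factors_on_left A X \<longleftrightarrow>
    {lact (dual_module X) (embed A a) f |a f. a \<in> carrier A \<and> f \<in> carrier (dual_module X)}
      = carrier (dual_module X)"


section \<open>Derivations, amenability and Connes amenability\<close>

definition derivation :: "('b, 'm) normed_space_scheme \<Rightarrow> ('b, 'v, 'n) bimodule_scheme \<Rightarrow>
    ('b \<Rightarrow> 'v) \<Rightarrow> bool" where
  "derivation B Y D \<longleftrightarrow> D \<in> carrier B \<rightarrow> carrier Y \<and>
    (\<forall>a\<in>carrier B. \<forall>b\<in>carrier B. D (a \<oplus>\<^bsub>B\<^esub> b) = D a \<oplus>\<^bsub>Y\<^esub> D b) \<and>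
    (\<forall>c. \<forall>a\<in>carrier B. D (c \<odot>\<^bsub>B\<^esub> a) = c \<odot>\<^bsub>Y\<^esub> D a) \<and>
    (\<forall>a\<in>carrier B. \<forall>b\<in>carrier B.
      D (a \<otimes>\<^bsub>B\<^esub> b) = ract Y (D a) b \<oplus>\<^bsub>Y\<^esub> lact Y a (D b))"

definition bounded_map :: "('b, 'm) normed_space_scheme \<Rightarrow> ('v, 'n) normed_space_scheme \<Rightarrow>
    ('b \<Rightarrow> 'v) \<Rightarrow> bool" where
  "bounded_map B Y D \<longleftrightarrow> (\<exists>K. \<forall>a\<in>carrier B. nrm Y (D a) \<le> K * nrm B a)"

definition inner_derivation :: "('b, 'm) normed_space_scheme \<Rightarrow> ('b, 'v, 'n) bimodule_scheme \<Rightarrow>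
    ('b \<Rightarrow> 'v) \<Rightarrow> bool" where
  "inner_derivation B Y D \<longleftrightarrow>
    (\<exists>y\<in>carrier Y. \<forall>a\<in>carrier B. D a = lact Y a y \<ominus>\<^bsub>Y\<^esub> ract Y y a)"

text \<open>
  HOL cannot quantify over types inside a formula, so the two amenability notions carry the type
  \<open>'u\<close> in which the modules \<open>X\<close> (whose duals are the coefficient modules) live.
\<close>

definition amenable :: "'u itself \<Rightarrow> ('b, 'm) normed_space_scheme \<Rightarrow> bool" where
  "amenable (U :: 'u itself) B \<longleftrightarrow>
    (\<forall>(X :: ('b, 'u) bimodule) D. banach_bimodule B X \<longrightarrow>
      derivation B (dual_module X) D \<longrightarrow> bounded_map B (dual_module X) D \<longrightarrow>
      inner_derivation B (dual_module X) D)"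

text \<open>
  In the next two definitions \<open>B\<close> is a dual Banach algebra whose underlying Banach space is
  \<open>dual P\<close>; the predual \<open>P\<close> enters through the weak* topology of \<open>B\<close>. The dual module is
  \<open>dual_module X\<close>, with predual \<open>X\<close>.
\<close>

definition normal_dual_module :: "('p, 'l) normed_space_scheme \<Rightarrow>
    ('p \<Rightarrow> complex, 'm) normed_space_scheme \<Rightarrow> ('p \<Rightarrow> complex, 'v, 'n) bimodule_scheme \<Rightarrow> bool" where
  "normal_dual_module P B X \<longleftrightarrow> banach_bimodule B X \<and>
    (\<forall>f\<in>carrier (dual_module X).
      continuous_map (weakstar P) (weakstar X) (\<lambda>a. lact (dual_module X) a f) \<and>
      continuous_map (weakstar P) (weakstar X) (\<lambda>a. ract (dual_module X) f a))"

definition connes_amenable :: "'u itself \<Rightarrow> ('p, 'l) normed_space_scheme \<Rightarrow>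
    ('p \<Rightarrow> complex, 'm) normed_space_scheme \<Rightarrow> bool" where
  "connes_amenable (U :: 'u itself) P B \<longleftrightarrow>
    (\<forall>(X :: ('p \<Rightarrow> complex, 'u) bimodule) D. normal_dual_module P B X \<longrightarrow>
      derivation B (dual_module X) D \<longrightarrow> continuous_map (weakstar P) (weakstar X) D \<longrightarrow>
      inner_derivation B (dual_module X) D)"

text \<open>
  The type of modules used for an algebra on the type \<open>'a\<close>: it contains the bidual and an arbitrary
  further type \<open>'x\<close>, so that modules of any size are covered. Since it is at least as large as the
  bidual, passing to submodules with at most that many elements shows that each of the properties
  quantified over this type does not depend on \<open>'x\<close>.
\<close>

type_synonym ('a, 'x) universe = "(('a \<Rightarrow> complex) \<Rightarrow> complex) + 'x"


section \<open>The Arens products as iterated limits\<close>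

lemma (in complex_normed_space) nrm_nonneg:
  assumes "x \<in> carrier V"
  shows "0 \<le> nrm V x"
proof -
  have neg: "(-1::complex) \<odot> x \<in> carrier V"
    using smult_closed[of "-1" x] assms by (simp add: complex_field_def)
  have "x \<oplus> ((-1::complex) \<odot> x) = (0::complex) \<odot> x"
    using smult_l_distr[of 1 "-1" x] smult_one[of x] assms
    by (simp add: complex_field_def)
  then have "nrm V (x \<oplus> ((-1::complex) \<odot> x)) = 0"
    using nrm_smult[of x 0] assms by simp
  then show ?thesis
    using nrm_triangle[OF assms neg] nrm_smult[OF assms, of "-1"] by simp
qed

lemma dual_nrm_le:
  assumes "complex_normed_space V" "0 \<le> K" "\<And>x. x \<in> carrier V \<Longrightarrow> cmod (f x) \<le> K * nrm V x"
  shows "nrm (dual V) f \<le> K"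
proof -
  interpret complex_normed_space V by fact
  have "\<zero>\<^bsub>V\<^esub> \<in> {x \<in> carrier V. nrm V x \<le> 1}" using nrm_eq_0_iff[of "\<zero>\<^bsub>V\<^esub>"] by auto
  moreover have "cmod (f x) \<le> K" if "x \<in> carrier V" "nrm V x \<le> 1" for x
    using assms(3)[OF that(1)] mult_left_mono[OF that(2) assms(2)] by simp
  ultimately show ?thesis
    unfolding dual_def by (auto intro!: cSUP_least)
qed

context banach_algebra
begin

lemma smult_in: "x \<in> carrier A \<Longrightarrow> (c::complex) \<odot> x \<in> carrier A"
  using smult_closed[of c x] by (simp add: complex_field_def)

lemma functional_bound:
  assumes "f \<in> carrier (dual A)"
  shows "\<exists>K\<ge>0. \<forall>x\<in>carrier A. cmod (f x) \<le> K * nrm A x"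
proof -
  from assms obtain K where K: "\<forall>x\<in>carrier A. cmod (f x) \<le> K * nrm A x"
    by (auto simp: dual_def functionals_def)
  have "cmod (f x) \<le> \<bar>K\<bar> * nrm A x" if "x \<in> carrier A" for x
    using K that nrm_nonneg[OF that] by (meson abs_ge_self mult_right_mono order_trans)
  then show ?thesis by (intro exI[of _ "\<bar>K\<bar>"]) auto
qed

lemma translate_bound:
  assumes "f \<in> carrier (dual A)"
  shows "\<exists>K\<ge>0. \<forall>a\<in>carrier A. \<forall>b\<in>carrier A. cmod (f (a \<otimes> b)) \<le> K * nrm A a * nrm A b"
proof -
  obtain K where K: "0 \<le> K" "\<And>x. x \<in> carrier A \<Longrightarrow> cmod (f x) \<le> K * nrm A x"
    using functional_bound[OF assms] by auto
  have "cmod (f (a \<otimes> b)) \<le> K * nrm A a * nrm A b" if "a \<in> carrier A" "b \<in> carrier A" for a b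
    using K(2)[OF mult_closed[OF that]] mult_left_mono[OF nrm_mult[OF that] K(1)]
    by (simp add: mult.assoc)
  then show ?thesis using K(1) by auto
qed

lemma translate_left_functional:
  assumes "f \<in> carrier (dual A)" "a \<in> carrier A"
  shows "(\<lambda>b\<in>carrier A. f (a \<otimes> b)) \<in> carrier (dual A)"
proof -
  obtain K where "0 \<le> K" and K: "\<And>a b. a \<in> carrier A \<Longrightarrow> b \<in> carrier A
      \<Longrightarrow> cmod (f (a \<otimes> b)) \<le> K * nrm A a * nrm A b"
    using translate_bound[OF assms(1)] by auto
  have "\<exists>K. \<forall>b\<in>carrier A. cmod (f (a \<otimes> b)) \<le> K * nrm A b"
    using K[OF assms(2)] by blast
  then show ?thesis
    using assms by (auto simp: dual_def functionals_def mult_closed smult_in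
        mult_add_right mult_smult_right)
qed

lemma translate_right_functional:
  assumes "f \<in> carrier (dual A)" "a \<in> carrier A"
  shows "(\<lambda>b\<in>carrier A. f (b \<otimes> a)) \<in> carrier (dual A)"
proof -
  obtain K where "0 \<le> K" and K: "\<And>a b. a \<in> carrier A \<Longrightarrow> b \<in> carrier A
      \<Longrightarrow> cmod (f (a \<otimes> b)) \<le> K * nrm A a * nrm A b"
    using translate_bound[OF assms(1)] by auto
  have "cmod (f (b \<otimes> a)) \<le> (K * nrm A a) * nrm A b" if "b \<in> carrier A" for b
    using K[OF that assms(2)] by (simp add: mult_ac)
  then have "\<exists>K. \<forall>b\<in>carrier A. cmod (f (b \<otimes> a)) \<le> K * nrm A b" by blast
  then show ?thesis
    using assms by (auto simp: dual_def functionals_def mult_closed smult_in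
        mult_add_left mult_smult_left)
qed

lemma bidual_add:
  assumes "p \<in> carrier (bidual A)" "f \<in> carrier (dual A)" "g \<in> carrier (dual A)"
  shows "p (\<lambda>x\<in>carrier A. f x + g x) = p f + p g"
  using assms by (auto simp: bidual_def dual_def functionals_def)

lemma bidual_smult:
  assumes "p \<in> carrier (bidual A)" "f \<in> carrier (dual A)"
  shows "p (\<lambda>x\<in>carrier A. c * f x) = c * p f"
  using assms by (auto simp: bidual_def dual_def functionals_def)

lemma bidual_bound:
  assumes "p \<in> carrier (bidual A)"
  shows "\<exists>K\<ge>0. \<forall>f\<in>carrier (dual A). \<forall>M\<ge>0.
    (\<forall>x\<in>carrier A. cmod (f x) \<le> M * nrm A x) \<longrightarrow> cmod (p f) \<le> K * M"
proof -
  from assms have "p \<in> functionals (dual A)" by (simp add: bidual_def dual_def)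
  then obtain K where K: "\<forall>f\<in>carrier (dual A). cmod (p f) \<le> K * nrm (dual A) f"
    unfolding functionals_def by blast
  have "cmod (p f) \<le> \<bar>K\<bar> * M"
    if f: "f \<in> carrier (dual A)" and M: "0 \<le> M"
      "\<forall>x\<in>carrier A. cmod (f x) \<le> M * nrm A x" for f M
  proof -
    have zero: "\<zero> \<in> {x \<in> carrier A. nrm A x \<le> 1}" using nrm_eq_0_iff[of "\<zero>"] by auto
    have "cmod (f x) \<le> M" if "x \<in> carrier A" "nrm A x \<le> 1" for x
      using M(2) that mult_left_mono[OF that(2) M(1)] by fastforce
    then have "bdd_above ((\<lambda>x. cmod (f x)) ` {x \<in> carrier A. nrm A x \<le> 1})"
      by (intro bdd_aboveI2[of _ _ M]) auto
    then have "cmod (f \<zero>) \<le> nrm (dual A) f"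
      unfolding dual_def using cSUP_upper[OF zero, of "\<lambda>x. cmod (f x)"] by simp
    then have nn: "0 \<le> nrm (dual A) f"
      using norm_ge_zero order_trans by blast
    have le: "nrm (dual A) f \<le> M"
      using M by (intro dual_nrm_le) (auto intro: complex_normed_space_axioms)
    have "cmod (p f) \<le> \<bar>K\<bar> * nrm (dual A) f"
      using bspec[OF K f] mult_right_mono[OF abs_ge_self nn, of K] by linarith
    also have "\<dots> \<le> \<bar>K\<bar> * M" using le by (intro mult_left_mono) auto
    finally show ?thesis .
  qed
  then show ?thesis by (intro exI[of _ "\<bar>K\<bar>"]) auto
qed

lemma functional_left_in_dual:
  assumes p: "p \<in> carrier (bidual A)" and f: "f \<in> carrier (dual A)"
  shows "functional_left A p f \<in> carrier (dual A)"
proof -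
  let ?t = "\<lambda>a. \<lambda>b\<in>carrier A. f (a \<otimes> b)"
  obtain K where K: "\<And>f M. f \<in> carrier (dual A) \<Longrightarrow> 0 \<le> M
      \<Longrightarrow> \<forall>x\<in>carrier A. cmod (f x) \<le> M * nrm A x \<Longrightarrow> cmod (p f) \<le> K * M"
    using bidual_bound[OF p] by auto
  obtain L where L: "0 \<le> L" "\<And>a b. a \<in> carrier A \<Longrightarrow> b \<in> carrier A
      \<Longrightarrow> cmod (f (a \<otimes> b)) \<le> L * nrm A a * nrm A b"
    using translate_bound[OF f] by auto
  note t = translate_left_functional[OF f]
  have lin: "f (x \<oplus> y) = f x + f y" "f (c \<odot> x) = c * f x"
    if "x \<in> carrier A" "y \<in> carrier A" for x y c
    using f that by (auto simp: dual_def functionals_def)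
  have sum: "?t (x \<oplus> y) = (\<lambda>b\<in>carrier A. ?t x b + ?t y b)"
    if "x \<in> carrier A" "y \<in> carrier A" for x y
    using that by (auto simp: mult_add_left mult_closed lin)
  have 1: "p (?t (x \<oplus> y)) = p (?t x) + p (?t y)"
    if "x \<in> carrier A" "y \<in> carrier A" for x y
    by (subst sum[OF that]) (rule bidual_add[OF p t[OF that(1)] t[OF that(2)]])
  have scaled: "?t (c \<odot> x) = (\<lambda>b\<in>carrier A. c * ?t x b)" if "x \<in> carrier A" for x c
    using that by (auto simp: mult_smult_left mult_closed lin)
  have 2: "p (?t (c \<odot> x)) = c * p (?t x)" if "x \<in> carrier A" for x c
    by (subst scaled[OF that]) (rule bidual_smult[OF p t[OF that]])
  have "cmod (p (?t x)) \<le> (K * L) * nrm A x" if x: "x \<in> carrier A" for x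
    using K[OF t[OF x], of "L * nrm A x"] L(1) L(2)[OF x] nrm_nonneg[OF x]
    by (simp add: mult.assoc)
  then have "\<exists>K. \<forall>x\<in>carrier A. cmod (p (?t x)) \<le> K * nrm A x" by blast
  with 1 2 show ?thesis
    by (auto simp: dual_def functionals_def functional_left_def smult_in)
qed

lemma functional_right_in_dual:
  assumes p: "p \<in> carrier (bidual A)" and f: "f \<in> carrier (dual A)"
  shows "functional_right A f p \<in> carrier (dual A)"
proof -
  let ?t = "\<lambda>a. \<lambda>b\<in>carrier A. f (b \<otimes> a)"
  obtain K where K: "\<And>f M. f \<in> carrier (dual A) \<Longrightarrow> 0 \<le> M
      \<Longrightarrow> \<forall>x\<in>carrier A. cmod (f x) \<le> M * nrm A x \<Longrightarrow> cmod (p f) \<le> K * M"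
    using bidual_bound[OF p] by auto
  obtain L where L: "0 \<le> L" "\<And>a b. a \<in> carrier A \<Longrightarrow> b \<in> carrier A
      \<Longrightarrow> cmod (f (a \<otimes> b)) \<le> L * nrm A a * nrm A b"
    using translate_bound[OF f] by auto
  note t = translate_right_functional[OF f]
  have lin: "f (x \<oplus> y) = f x + f y" "f (c \<odot> x) = c * f x"
    if "x \<in> carrier A" "y \<in> carrier A" for x y c
    using f that by (auto simp: dual_def functionals_def)
  have sum: "?t (x \<oplus> y) = (\<lambda>b\<in>carrier A. ?t x b + ?t y b)"
    if "x \<in> carrier A" "y \<in> carrier A" for x y
    using that by (auto simp: mult_add_right mult_closed lin)
  have 1: "p (?t (x \<oplus> y)) = p (?t x) + p (?t y)"
    if "x \<in> carrier A" "y \<in> carrier A" for x y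
    by (subst sum[OF that]) (rule bidual_add[OF p t[OF that(1)] t[OF that(2)]])
  have scaled: "?t (c \<odot> x) = (\<lambda>b\<in>carrier A. c * ?t x b)" if "x \<in> carrier A" for x c
    using that by (auto simp: mult_smult_right mult_closed lin)
  have 2: "p (?t (c \<odot> x)) = c * p (?t x)" if "x \<in> carrier A" for x c
    by (subst scaled[OF that]) (rule bidual_smult[OF p t[OF that]])
  have "cmod (p (?t x)) \<le> (K * L) * nrm A x" if x: "x \<in> carrier A" for x
  proof -
    have "cmod (f (b \<otimes> x)) \<le> L * nrm A x * nrm A b" if "b \<in> carrier A" for b
      using L(2)[OF that x] by (simp add: mult_ac)
    then show ?thesis
      using K[OF t[OF x], of "L * nrm A x"] L(1) nrm_nonneg[OF x]
      by (simp add: mult.assoc)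
  qed
  then have "\<exists>K. \<forall>x\<in>carrier A. cmod (p (?t x)) \<le> K * nrm A x" by blast
  with 1 2 show ?thesis
    by (auto simp: dual_def functionals_def functional_right_def smult_in)
qed

lemma arens1_iterated_limit:
  assumes "p \<in> carrier (bidual A)" "q \<in> carrier (bidual A)" "f \<in> carrier (dual A)"
    and a: "\<And>i. a i \<in> carrier A" "\<And>g. g \<in> carrier (dual A) \<Longrightarrow> ((\<lambda>i. g (a i)) \<longlongrightarrow> p g) F"
    and b: "\<And>j. b j \<in> carrier A" "\<And>g. g \<in> carrier (dual A) \<Longrightarrow> ((\<lambda>j. g (b j)) \<longlongrightarrow> q g) G"
  shows "\<exists>h. (\<forall>i. ((\<lambda>j. f (a i \<otimes> b j)) \<longlongrightarrow> h i) G) \<and> (h \<longlongrightarrow> arens1 A p q f) F"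
proof (intro exI conjI allI)
  show "((\<lambda>j. f (a i \<otimes> b j)) \<longlongrightarrow> functional_left A q f (a i)) G" for i
    using b(2)[OF translate_left_functional[OF assms(3) a(1)], of i] a(1) b(1)
    by (simp add: functional_left_def)
  show "((\<lambda>i. functional_left A q f (a i)) \<longlongrightarrow> arens1 A p q f) F"
    using a(2)[OF functional_left_in_dual[OF assms(2,3)]] assms(3) by (simp add: arens1_def)
qed

lemma arens2_iterated_limit:
  assumes "p \<in> carrier (bidual A)" "q \<in> carrier (bidual A)" "f \<in> carrier (dual A)"
    and a: "\<And>i. a i \<in> carrier A" "\<And>g. g \<in> carrier (dual A) \<Longrightarrow> ((\<lambda>i. g (a i)) \<longlongrightarrow> p g) F"
    and b: "\<And>j. b j \<in> carrier A" "\<And>g. g \<in> carrier (dual A) \<Longrightarrow> ((\<lambda>j. g (b j)) \<longlongrightarrow> q g) G"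
  shows "\<exists>h. (\<forall>j. ((\<lambda>i. f (a i \<otimes> b j)) \<longlongrightarrow> h j) F) \<and> (h \<longlongrightarrow> arens2 A p q f) G"
proof (intro exI conjI allI)
  show "((\<lambda>i. f (a i \<otimes> b j)) \<longlongrightarrow> functional_right A f p (b j)) F" for j
    using a(2)[OF translate_right_functional[OF assms(3) b(1)], of j] a(1) b(1)
    by (simp add: functional_right_def)
  show "((\<lambda>j. functional_right A f p (b j)) \<longlongrightarrow> arens2 A p q f) G"
    using b(2)[OF functional_right_in_dual[OF assms(1,3)]] assms(3) by (simp add: arens2_def)
qed

end

end

theory Submission
  imports Defs
begin

text \<open>
  The hypotheses force \<open>A\<close> to be reflexive, indeed \<open>A = A**\<close> under the canonical embedding, and for
  such an algebra Connes amenability of \<open>A**\<close> is plain amenability of \<open>A\<close>.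

  To see this, apply the factorization hypothesis to one particular module, \<open>X = A*\<close>. Since \<open>A\<close>
  is Arens regular, \<open>A*\<close> is a Banach \<open>A**\<close>-bimodule (\<open>banach_bimodule_dual\<close>): regularity says
  exactly that iterated limits may be interchanged, which makes the left and right actions
  commute. A weak* cluster point of the bounded approximate identity is an element \<open>E\<close> of \<open>A**\<close> with
  \<open>E.f = f = f.E\<close> for all functionals \<open>f\<close> (\<open>bidual_identity_on_dual\<close>), so \<open>A*\<close> is neo-unital. The
  dual module of \<open>A*\<close> is \<open>A**\<close>, and the left action of \<open>A\<close> on it is the first Arens product; hence
  the hypothesis says \<open>A A** = A**\<close> (\<open>bidual_factors\<close>). But \<open>A A**\<close> is contained in \<open>A\<close> because \<open>A\<close>
  is a right ideal, so the embedding of \<open>A\<close> into \<open>A**\<close> is onto (\<open>embed_surj\<close>).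

  By the Hahn-Banach theorem the embedding does not decrease norms, so its inverse \<open>\<theta>\<close> is a bounded
  isomorphism of \<open>A**\<close> onto \<open>A\<close>. Any Banach \<open>A\<close>-module \<open>X\<close> is thereby an \<open>A**\<close>-module, and a bounded
  derivation \<open>D\<close> of \<open>A\<close> gives the derivation \<open>D \<circ> \<theta>\<close> of \<open>A**\<close> into the same dual module. Weak*
  convergence in \<open>A**\<close> is now weak convergence in \<open>A\<close>, and bounded operators into a dual space are
  weak-weak* continuous (\<open>weakstar_continuous_of_bounded\<close>). Therefore the dual module is normal,
  \<open>D \<circ> \<theta>\<close> is weak* continuous, and Connes amenability makes it inner.
\<close>

section \<open>Normed spaces with explicit carriers\<close>

context complex_normed_space
begin

lemma scale_closed: "x \<in> carrier V \<Longrightarrow> (c::complex) \<odot> x \<in> carrier V"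
  using smult_closed[of c x] by (simp add: complex_field_def)

lemma scale_add_left: "x \<in> carrier V \<Longrightarrow> (c + d :: complex) \<odot> x = c \<odot> x \<oplus> d \<odot> x"
  using smult_l_distr[of c d x] by (simp add: complex_field_def)

lemma scale_add_right:
  "\<lbrakk>x \<in> carrier V; y \<in> carrier V\<rbrakk> \<Longrightarrow> (c::complex) \<odot> (x \<oplus> y) = c \<odot> x \<oplus> c \<odot> y"
  using smult_r_distr[of c x y] by (simp add: complex_field_def)

lemma scale_scale: "x \<in> carrier V \<Longrightarrow> (c::complex) \<odot> (d \<odot> x) = (c * d) \<odot> x"
  using smult_assoc1[of c d x] by (simp add: complex_field_def)

lemma scale_one: "x \<in> carrier V \<Longrightarrow> (1::complex) \<odot> x = x"
  using smult_one[of x] by (simp add: complex_field_def)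

lemma scale_zero: "x \<in> carrier V \<Longrightarrow> (0::complex) \<odot> x = \<zero>"
  using smult_l_null[of x] by (simp add: complex_field_def)

lemma neg_add: "x \<in> carrier V \<Longrightarrow> (-1::complex) \<odot> x \<oplus> x = \<zero>"
  using scale_add_left[of x "-1" 1] by (simp add: scale_one scale_zero)

lemma add_neg: "x \<in> carrier V \<Longrightarrow> x \<oplus> (-1::complex) \<odot> x = \<zero>"
  using scale_add_left[of x 1 "-1"] by (simp add: scale_one scale_zero)

lemma uminus_eq_scale: "x \<in> carrier V \<Longrightarrow> \<ominus> x = (-1::complex) \<odot> x"
  using neg_add scale_closed M.minus_equality by auto

lemma minus_eq_scale:
  "\<lbrakk>x \<in> carrier V; y \<in> carrier V\<rbrakk> \<Longrightarrow> x \<ominus> y = x \<oplus> (-1::complex) \<odot> y"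
  by (simp add: a_minus_def uminus_eq_scale)

lemma nrm_zero: "nrm V \<zero> = 0"
  by (simp add: nrm_eq_0_iff)

end

lemma complex_normed_spaceI:
  fixes V :: "('v, 'm) normed_space_scheme" (structure)
  assumes add: "\<And>x y. \<lbrakk>x \<in> carrier V; y \<in> carrier V\<rbrakk> \<Longrightarrow> x \<oplus> y \<in> carrier V"
    and zero: "\<zero> \<in> carrier V"
    and assoc: "\<And>x y z. \<lbrakk>x \<in> carrier V; y \<in> carrier V; z \<in> carrier V\<rbrakk>
      \<Longrightarrow> (x \<oplus> y) \<oplus> z = x \<oplus> (y \<oplus> z)"
    and comm: "\<And>x y. \<lbrakk>x \<in> carrier V; y \<in> carrier V\<rbrakk> \<Longrightarrow> x \<oplus> y = y \<oplus> x"
    and neutral: "\<And>x. x \<in> carrier V \<Longrightarrow> \<zero> \<oplus> x = x"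
    and scale: "\<And>c x. x \<in> carrier V \<Longrightarrow> (c::complex) \<odot> x \<in> carrier V"
    and scale_0: "\<And>x. x \<in> carrier V \<Longrightarrow> (0::complex) \<odot> x = \<zero>"
    and scale_1: "\<And>x. x \<in> carrier V \<Longrightarrow> (1::complex) \<odot> x = x"
    and distl: "\<And>c d x. x \<in> carrier V \<Longrightarrow> (c + d :: complex) \<odot> x = c \<odot> x \<oplus> d \<odot> x"
    and distr: "\<And>c x y. \<lbrakk>x \<in> carrier V; y \<in> carrier V\<rbrakk>
      \<Longrightarrow> (c::complex) \<odot> (x \<oplus> y) = c \<odot> x \<oplus> c \<odot> y"
    and scale_scale: "\<And>c d x. x \<in> carrier V \<Longrightarrow> (c * d :: complex) \<odot> x = c \<odot> (d \<odot> x)"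
    and nrm_0: "\<And>x. x \<in> carrier V \<Longrightarrow> nrm V x = 0 \<longleftrightarrow> x = \<zero>"
    and nrm_add: "\<And>x y. \<lbrakk>x \<in> carrier V; y \<in> carrier V\<rbrakk> \<Longrightarrow> nrm V (x \<oplus> y) \<le> nrm V x + nrm V y"
    and nrm_smult: "\<And>c x. x \<in> carrier V \<Longrightarrow> nrm V ((c::complex) \<odot> x) = cmod c * nrm V x"
  shows "complex_normed_space V"
proof -
  have "\<exists>y\<in>carrier V. y \<oplus> x = \<zero>" if "x \<in> carrier V" for x
    using distl[OF that, of "-1" 1] scale[OF that, of "-1"] that
    by (auto simp: scale_0 scale_1)
  then have "abelian_group V"
    by (intro abelian_groupI add zero assoc comm neutral)
  then have "module complex_field V"
    by (intro moduleI cring_complex_field)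
      (auto simp: complex_field_def intro: scale scale_1 distl distr scale_scale)
  then show ?thesis
    by (intro complex_normed_space.intro complex_normed_space_axioms.intro nrm_0 nrm_add nrm_smult)
qed

text \<open>
  Spaces are records, so replacing one field (such as the product of the bidual) or renaming the
  elements produces a formally different space. This lemma carries the Banach space axioms across
  any such change.
\<close>

lemma banach_space_isometric_copy:
  assumes "banach_space V" and bij: "bij_betw h (carrier V) (carrier W)"
    and add: "\<And>x y. \<lbrakk>x \<in> carrier V; y \<in> carrier V\<rbrakk> \<Longrightarrow> h (x \<oplus>\<^bsub>V\<^esub> y) = h x \<oplus>\<^bsub>W\<^esub> h y"
    and scale: "\<And>c x. x \<in> carrier V \<Longrightarrow> h (c \<odot>\<^bsub>V\<^esub> x) = c \<odot>\<^bsub>W\<^esub> h x"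
    and zero: "h \<zero>\<^bsub>V\<^esub> = \<zero>\<^bsub>W\<^esub>"
    and nrm: "\<And>x. x \<in> carrier V \<Longrightarrow> nrm W (h x) = nrm V x"
  shows "banach_space W"
proof -
  interpret V: banach_space V by fact
  have W: "carrier W = h ` carrier V" using bij by (simp add: bij_betw_def)
  have inj: "inj_on h (carrier V)" using bij by (simp add: bij_betw_def)
  note simps = add[symmetric] scale[symmetric] zero[symmetric] nrm inj_onD[OF inj]
    V.scale_closed V.scale_add_left V.scale_add_right V.scale_scale V.scale_one V.scale_zero
    V.nrm_smult V.nrm_triangle
  have zero_iff: "h x = h \<zero>\<^bsub>V\<^esub> \<longleftrightarrow> x = \<zero>\<^bsub>V\<^esub>" if "x \<in> carrier V" for x
    using inj_onD[OF inj _ that V.M.zero_closed] by auto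
  interpret W: complex_normed_space W
    by (rule complex_normed_spaceI; (unfold W, elim imageE)?)
      (auto simp: simps W zero_iff V.nrm_eq_0_iff V.M.a_ac)
  have diff: "h x \<ominus>\<^bsub>W\<^esub> h y = h (x \<ominus>\<^bsub>V\<^esub> y)" if "x \<in> carrier V" "y \<in> carrier V" for x y
    using that by (simp add: W.minus_eq_scale V.minus_eq_scale W simps)
  show ?thesis
  proof (intro banach_space.intro banach_space_axioms.intro)
    fix s :: "nat \<Rightarrow> _"
    assume s: "\<And>n. s n \<in> carrier W"
      and cauchy: "\<And>e. e > 0 \<Longrightarrow> \<exists>N. \<forall>m\<ge>N. \<forall>n\<ge>N. nrm W (s m \<ominus>\<^bsub>W\<^esub> s n) < e"
    from s have "\<forall>n. \<exists>x\<in>carrier V. s n = h x" by (auto simp: W)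
    then obtain t where t: "\<And>n. t n \<in> carrier V" and st: "\<And>n. s n = h (t n)" by metis
    have "\<exists>l\<in>carrier V. (\<lambda>n. nrm V (t n \<ominus>\<^bsub>V\<^esub> l)) \<longlonglongrightarrow> 0"
      using cauchy t by (intro V.complete) (simp_all add: st diff nrm)
    then show "\<exists>l\<in>carrier W. (\<lambda>n. nrm W (s n \<ominus>\<^bsub>W\<^esub> l)) \<longlonglongrightarrow> 0"
      using t by (auto simp: W st diff nrm)
  qed (rule W.complex_normed_space_axioms)
qed

section \<open>The dual of a normed space is a Banach space\<close>

lemma dual_simps:
  "\<zero>\<^bsub>dual V\<^esub> = (\<lambda>x\<in>carrier V. 0)"
  "f \<oplus>\<^bsub>dual V\<^esub> g = (\<lambda>x\<in>carrier V. f x + g x)"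
  "c \<odot>\<^bsub>dual V\<^esub> f = (\<lambda>x\<in>carrier V. c * f x)"
  by (simp_all add: dual_def)

lemma dual_carrier: "carrier (dual V) = functionals V"
  by (simp add: dual_def)

lemma
  assumes "f \<in> carrier (dual V)"
  shows dual_extensional: "f \<in> extensional (carrier V)"
    and dual_add: "\<lbrakk>x \<in> carrier V; y \<in> carrier V\<rbrakk> \<Longrightarrow> f (x \<oplus>\<^bsub>V\<^esub> y) = f x + f y"
    and dual_scale: "x \<in> carrier V \<Longrightarrow> f (c \<odot>\<^bsub>V\<^esub> x) = c * f x"
  using assms by (auto simp: dual_carrier functionals_def)

lemma dual_memI:
  assumes "f \<in> extensional (carrier V)"
    and "\<And>x y. \<lbrakk>x \<in> carrier V; y \<in> carrier V\<rbrakk> \<Longrightarrow> f (x \<oplus>\<^bsub>V\<^esub> y) = f x + f y"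
    and "\<And>c x. x \<in> carrier V \<Longrightarrow> f (c \<odot>\<^bsub>V\<^esub> x) = c * f x"
    and "\<And>x. x \<in> carrier V \<Longrightarrow> cmod (f x) \<le> K * nrm V x"
  shows "f \<in> carrier (dual V)"
  using assms unfolding dual_carrier functionals_def by blast

context complex_normed_space
begin

lemma dual_bdd_above:
  assumes "f \<in> carrier (dual V)"
  shows "bdd_above ((\<lambda>y. cmod (f y)) ` {y \<in> carrier V. nrm V y \<le> 1})"
proof -
  obtain K where K: "\<And>y. y \<in> carrier V \<Longrightarrow> cmod (f y) \<le> K * nrm V y"
    using assms unfolding dual_carrier functionals_def by blast
  have "cmod (f y) \<le> \<bar>K\<bar>" if "y \<in> carrier V" "nrm V y \<le> 1" for y
  proof -
    have "K * nrm V y \<le> \<bar>K\<bar> * 1"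
      using that nrm_nonneg[OF that(1)] by (intro mult_mono) auto
    then show ?thesis using K[OF that(1)] by simp
  qed
  then show ?thesis by (intro bdd_aboveI2[of _ _ "\<bar>K\<bar>"]) auto
qed

lemma dual_bound:
  assumes f: "f \<in> carrier (dual V)" and x: "x \<in> carrier V"
  shows "cmod (f x) \<le> nrm (dual V) f * nrm V x"
proof -
  obtain K where K: "\<And>y. y \<in> carrier V \<Longrightarrow> cmod (f y) \<le> K * nrm V y"
    using f unfolding dual_carrier functionals_def by blast
  show ?thesis
  proof (cases "nrm V x = 0")
    case True
    then show ?thesis using K[OF x] by simp
  next
    case False
    then have pos: "nrm V x > 0" using nrm_nonneg[OF x] by simp
    let ?y = "complex_of_real (1 / nrm V x) \<odot> x"
    have "?y \<in> {y \<in> carrier V. nrm V y \<le> 1}"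
      using x pos by (simp add: scale_closed nrm_smult norm_divide)
    then have "cmod (f ?y) \<le> nrm (dual V) f"
      using cSUP_upper[OF _ dual_bdd_above[OF f]] by (simp add: dual_def)
    then show ?thesis
      using pos x f by (simp add: dual_scale norm_mult norm_divide field_simps)
  qed
qed

lemma dual_nrm_nonneg:
  assumes "f \<in> carrier (dual V)"
  shows "0 \<le> nrm (dual V) f"
proof -
  have "cmod (f \<zero>) \<le> nrm (dual V) f"
    using cSUP_upper[OF _ dual_bdd_above[OF assms], of \<zero>] by (simp add: dual_def nrm_zero)
  then show ?thesis using norm_ge_zero order_trans by blast
qed

lemma dual_nrm_leI:
  "\<lbrakk>0 \<le> K; \<And>x. x \<in> carrier V \<Longrightarrow> cmod (f x) \<le> K * nrm V x\<rbrakk> \<Longrightarrow> nrm (dual V) f \<le> K"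
  by (rule dual_nrm_le[OF complex_normed_space_axioms])

lemma dual_add_closed:
  assumes "f \<in> carrier (dual V)" "g \<in> carrier (dual V)"
  shows "(\<lambda>x\<in>carrier V. f x + g x) \<in> carrier (dual V)"
proof (rule dual_memI)
  fix x assume x: "x \<in> carrier V"
  show "cmod ((\<lambda>x\<in>carrier V. f x + g x) x) \<le> (nrm (dual V) f + nrm (dual V) g) * nrm V x"
    using dual_bound[OF assms(1) x] dual_bound[OF assms(2) x] norm_triangle_ineq[of "f x" "g x"] x
    by (simp add: distrib_right)
qed (use assms in \<open>auto simp: dual_add dual_scale scale_closed algebra_simps\<close>)

lemma dual_scale_closed:
  assumes "f \<in> carrier (dual V)"
  shows "(\<lambda>x\<in>carrier V. c * f x) \<in> carrier (dual V)"
proof (rule dual_memI)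
  fix x assume x: "x \<in> carrier V"
  show "cmod ((\<lambda>x\<in>carrier V. c * f x) x) \<le> (cmod c * nrm (dual V) f) * nrm V x"
    using mult_left_mono[OF dual_bound[OF assms x], of "cmod c"] x
    by (simp add: norm_mult mult.assoc)
qed (use assms in \<open>auto simp: dual_add dual_scale scale_closed algebra_simps\<close>)

lemma dual_zero_closed: "(\<lambda>x\<in>carrier V. 0) \<in> carrier (dual V)"
  by (rule dual_memI[where K = 0]) (auto simp: scale_closed)

lemma dual_nrm_smult_le:
  assumes "f \<in> carrier (dual V)"
  shows "nrm (dual V) (\<lambda>x\<in>carrier V. c * f x) \<le> cmod c * nrm (dual V) f"
  using dual_bound[OF assms] dual_nrm_nonneg[OF assms]
  by (intro dual_nrm_leI) (auto simp: norm_mult mult.assoc intro!: mult_left_mono)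

lemma complex_normed_space_dual: "complex_normed_space (dual V)"
proof (rule complex_normed_spaceI; unfold dual_simps)
  fix f assume f: "f \<in> carrier (dual V)"
  show "(nrm (dual V) f = 0) = (f = (\<lambda>x\<in>carrier V. 0))"
  proof
    assume "nrm (dual V) f = 0"
    then have "f x = 0" if "x \<in> carrier V" for x using dual_bound[OF f that] by simp
    then show "f = (\<lambda>x\<in>carrier V. 0)"
      using dual_extensional[OF f] by (auto simp: fun_eq_iff extensional_def)
  next
    assume "f = (\<lambda>x\<in>carrier V. 0)"
    then have "nrm (dual V) f \<le> 0" by (intro dual_nrm_leI) auto
    then show "nrm (dual V) f = 0" using dual_nrm_nonneg[OF f] by simp
  qed
next
  fix f g assume f: "f \<in> carrier (dual V)" and g: "g \<in> carrier (dual V)"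
  show "nrm (dual V) (\<lambda>x\<in>carrier V. f x + g x) \<le> nrm (dual V) f + nrm (dual V) g"
  proof (rule dual_nrm_leI)
    fix x assume x: "x \<in> carrier V"
    show "cmod ((\<lambda>x\<in>carrier V. f x + g x) x) \<le> (nrm (dual V) f + nrm (dual V) g) * nrm V x"
      using dual_bound[OF f x] dual_bound[OF g x] norm_triangle_ineq[of "f x" "g x"] x
      by (simp add: distrib_right)
  qed (use f g dual_nrm_nonneg in simp)
next
  fix c f assume f: "f \<in> carrier (dual V)"
  let ?cf = "\<lambda>x\<in>carrier V. c * f x"
  show "nrm (dual V) ?cf = cmod c * nrm (dual V) f"
  proof (cases "c = 0")
    case True
    then have "nrm (dual V) ?cf \<le> 0" by (intro dual_nrm_leI) auto
    then show ?thesis using True dual_nrm_nonneg[OF dual_scale_closed[OF f, of c]] by simp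
  next
    case False
    have "(\<lambda>x\<in>carrier V. inverse c * ?cf x) = f"
      using False dual_extensional[OF f] by (auto simp: fun_eq_iff extensional_def)
    then have "nrm (dual V) f \<le> cmod (inverse c) * nrm (dual V) ?cf"
      using dual_nrm_smult_le[OF dual_scale_closed[OF f, of c], of "inverse c"] by simp
    then have "cmod c * nrm (dual V) f \<le> nrm (dual V) ?cf"
      using False by (simp add: norm_divide field_simps)
    then show ?thesis using dual_nrm_smult_le[OF f, of c] by simp
  qed
qed (use dual_add_closed dual_scale_closed dual_zero_closed in
    \<open>auto simp: fun_eq_iff algebra_simps dest!: dual_extensional simp: extensional_def\<close>)

lemma dual_minus:
  assumes "f \<in> carrier (dual V)" "g \<in> carrier (dual V)"
  shows "f \<ominus>\<^bsub>dual V\<^esub> g = (\<lambda>x\<in>carrier V. f x - g x)"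
proof -
  interpret D: complex_normed_space "dual V" by (rule complex_normed_space_dual)
  show ?thesis
    by (simp only: D.minus_eq_scale[OF assms]) (auto simp: dual_simps fun_eq_iff)
qed

text \<open>
  A Cauchy sequence of functionals converges pointwise because the complex numbers are complete;
  the uniform Cauchy estimate survives the pointwise limit, which makes the limit bounded and the
  convergence a convergence in norm.
\<close>

theorem banach_space_dual: "banach_space (dual V)"
proof (intro banach_space.intro banach_space_axioms.intro complex_normed_space_dual)
  fix s :: "nat \<Rightarrow> _"
  assume s: "\<And>n. s n \<in> carrier (dual V)"
    and cauchy: "\<And>e. e > 0 \<Longrightarrow> \<exists>N. \<forall>m\<ge>N. \<forall>n\<ge>N. nrm (dual V) (s m \<ominus>\<^bsub>dual V\<^esub> s n) < e"
  have diff_closed: "(\<lambda>x\<in>carrier V. s m x - g x) \<in> carrier (dual V)"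
    if "g \<in> carrier (dual V)" for m g
    using dual_add_closed[OF s[of m] dual_scale_closed[OF that, of "-1"]]
    by (rule back_subst[of "\<lambda>h. h \<in> carrier (dual V)"]) (auto simp: fun_eq_iff)
  have pointwise: "\<exists>N. \<forall>m\<ge>N. \<forall>n\<ge>N. \<forall>x\<in>carrier V. cmod (s m x - s n x) \<le> e * nrm V x"
    if e: "e > 0" for e
  proof -
    obtain N where N: "\<And>m n. m \<ge> N \<Longrightarrow> n \<ge> N \<Longrightarrow> nrm (dual V) (s m \<ominus>\<^bsub>dual V\<^esub> s n) < e"
      using cauchy[OF e] by blast
    have "cmod (s m x - s n x) \<le> e * nrm V x"
      if "m \<ge> N" "n \<ge> N" and x: "x \<in> carrier V" for m n x
    proof -
      have "nrm (dual V) (\<lambda>x\<in>carrier V. s m x - s n x) \<le> e"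
        using N[OF that(1,2)] by (simp add: dual_minus s)
      then show ?thesis
        using dual_bound[OF diff_closed[OF s, of m n] x] x
          mult_right_mono[OF _ nrm_nonneg[OF x]] by fastforce
    qed
    then show ?thesis by blast
  qed
  have "convergent (\<lambda>n. s n x)" if x: "x \<in> carrier V" for x
  proof (rule Cauchy_convergent, rule metric_CauchyI)
    fix e :: real assume e: "e > 0"
    let ?d = "e / (nrm V x + 1)"
    have pos: "nrm V x + 1 > 0" using nrm_nonneg[OF x] by simp
    then obtain N where N: "\<And>m n. m \<ge> N \<Longrightarrow> n \<ge> N \<Longrightarrow> cmod (s m x - s n x) \<le> ?d * nrm V x"
      using pointwise[of ?d] e x by (metis divide_pos_pos)
    have "?d * nrm V x < e" using pos e by (simp add: field_simps)
    then show "\<exists>N. \<forall>m\<ge>N. \<forall>n\<ge>N. dist (s m x) (s n x) < e"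
      using N by (intro exI[of _ N]) (force simp: dist_norm)
  qed
  then have lim: "(\<lambda>n. s n x) \<longlonglongrightarrow> lim (\<lambda>n. s n x)" if "x \<in> carrier V" for x
    using that by (simp add: convergent_LIMSEQ_iff)
  define l where "l = (\<lambda>x\<in>carrier V. lim (\<lambda>n. s n x))"
  have l: "(\<lambda>n. s n x) \<longlonglongrightarrow> l x" if "x \<in> carrier V" for x
    using lim that by (simp add: l_def)
  have approx: "\<exists>N. \<forall>m\<ge>N. \<forall>x\<in>carrier V. cmod (s m x - l x) \<le> e * nrm V x" if e: "e > 0" for e
  proof -
    obtain N where N: "\<And>m n x. \<lbrakk>m \<ge> N; n \<ge> N; x \<in> carrier V\<rbrakk>
        \<Longrightarrow> cmod (s m x - s n x) \<le> e * nrm V x"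
      using pointwise[OF e] by blast
    have "cmod (s m x - l x) \<le> e * nrm V x" if "m \<ge> N" "x \<in> carrier V" for m x
    proof (rule LIMSEQ_le_const2)
      show "(\<lambda>n. cmod (s m x - s n x)) \<longlonglongrightarrow> cmod (s m x - l x)"
        by (intro tendsto_intros l that)
    qed (use N that in blast)
    then show ?thesis by blast
  qed
  have l_mem: "l \<in> carrier (dual V)"
  proof -
    obtain N where N: "\<And>x. x \<in> carrier V \<Longrightarrow> cmod (s N x - l x) \<le> 1 * nrm V x"
      using approx[of 1] by auto
    show ?thesis
    proof (rule dual_memI)
      fix x assume x: "x \<in> carrier V"
      have "cmod (l x) \<le> cmod (s N x) + cmod (s N x - l x)"
        using norm_triangle_sub[of "l x" "s N x"] by (simp add: norm_minus_commute)
      then show "cmod (l x) \<le> (nrm (dual V) (s N) + 1) * nrm V x"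
        using N[OF x] dual_bound[OF s x, of N] by (simp add: distrib_right)
    next
      fix x y assume xy: "x \<in> carrier V" "y \<in> carrier V"
      have "(\<lambda>n. s n (x \<oplus> y)) \<longlonglongrightarrow> l x + l y"
        using tendsto_add[OF l[OF xy(1)] l[OF xy(2)]] xy s by (simp add: dual_add)
      then show "l (x \<oplus> y) = l x + l y"
        using LIMSEQ_unique l xy by blast
    next
      fix c x assume x: "x \<in> carrier V"
      have "(\<lambda>n. s n (c \<odot> x)) \<longlonglongrightarrow> c * l x"
        using tendsto_mult_left[OF l[OF x], of c] x s by (simp add: dual_scale)
      then show "l (c \<odot> x) = c * l x"
        using LIMSEQ_unique l[OF scale_closed[OF x]] by blast
    qed (simp add: l_def)
  qed
  have "(\<lambda>n. nrm (dual V) (s n \<ominus>\<^bsub>dual V\<^esub> l)) \<longlonglongrightarrow> 0"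
  proof (rule metric_LIMSEQ_I)
    fix e :: real assume e: "e > 0"
    obtain N where N: "\<And>m x. \<lbrakk>m \<ge> N; x \<in> carrier V\<rbrakk> \<Longrightarrow> cmod (s m x - l x) \<le> e / 2 * nrm V x"
      using approx[of "e / 2"] e by auto
    have "nrm (dual V) (\<lambda>x\<in>carrier V. s m x - l x) < e" if "m \<ge> N" for m
    proof -
      have "nrm (dual V) (\<lambda>x\<in>carrier V. s m x - l x) \<le> e / 2"
        using N[OF that] e by (intro dual_nrm_leI) auto
      then show ?thesis using e by simp
    qed
    then show "\<exists>N. \<forall>n\<ge>N. dist (nrm (dual V) (s n \<ominus>\<^bsub>dual V\<^esub> l)) 0 < e"
      using dual_nrm_nonneg[OF diff_closed[OF l_mem]]
      by (intro exI[of _ N]) (simp add: dual_minus s l_mem)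
  qed
  then show "\<exists>l\<in>carrier (dual V). (\<lambda>n. nrm (dual V) (s n \<ominus>\<^bsub>dual V\<^esub> l)) \<longlonglongrightarrow> 0"
    using l_mem by blast
qed

end

section \<open>The Hahn-Banach theorem: norming functionals\<close>

context complex_normed_space
begin

text \<open>
  The Hahn-Banach theorem in the form that each point has a norming functional. Rather than
  extending a functional step by step from a subspace, one looks for minimal elements among the
  sublinear functions below the norm: these turn out to be linear. All functions involved live on
  the whole space, which avoids partial functions.
\<close>

definition dominated_sublinear :: "('v \<Rightarrow> real) set" where
  "dominated_sublinear = {q \<in> extensional (carrier V).
      (\<forall>x\<in>carrier V. \<forall>y\<in>carrier V. q (x \<oplus> y) \<le> q x + q y) \<and>
      (\<forall>t>0. \<forall>x\<in>carrier V. q (complex_of_real t \<odot> x) \<le> t * q x) \<and>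
      (\<forall>x\<in>carrier V. q x \<le> nrm V x)}"

lemma
  assumes "q \<in> dominated_sublinear"
  shows sublinear_extensional: "q \<in> extensional (carrier V)"
    and sublinear_add: "\<lbrakk>x \<in> carrier V; y \<in> carrier V\<rbrakk> \<Longrightarrow> q (x \<oplus> y) \<le> q x + q y"
    and sublinear_scale_le: "\<lbrakk>t > 0; x \<in> carrier V\<rbrakk> \<Longrightarrow> q (complex_of_real t \<odot> x) \<le> t * q x"
    and sublinear_dominated: "x \<in> carrier V \<Longrightarrow> q x \<le> nrm V x"
  using assms by (auto simp: dominated_sublinear_def)

lemma sublinear_scale:
  assumes q: "q \<in> dominated_sublinear" and t: "t \<ge> 0" and x: "x \<in> carrier V"
  shows "q (complex_of_real t \<odot> x) = t * q x"
proof (cases "t = 0")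
  case True
  have "q \<zero> \<le> 2 * q \<zero>"
    using sublinear_add[OF q, of \<zero> \<zero>] by simp
  then have "q \<zero> = 0"
    using sublinear_dominated[OF q, of \<zero>] by (simp add: nrm_zero)
  then show ?thesis using True x by (simp add: scale_zero)
next
  case False
  then have "q (complex_of_real (1 / t) \<odot> (complex_of_real t \<odot> x))
      \<le> 1 / t * q (complex_of_real t \<odot> x)"
    using t x by (intro sublinear_scale_le[OF q]) (auto simp: scale_closed)
  then have "t * q x \<le> q (complex_of_real t \<odot> x)"
    using False t x by (simp add: scale_scale scale_one field_simps flip: of_real_mult)
  then show ?thesis using sublinear_scale_le[OF q, of t x] False t x by simp
qed

lemma sublinear_lower:
  assumes q: "q \<in> dominated_sublinear" and x: "x \<in> carrier V"
  shows "- q ((-1::complex) \<odot> x) \<le> q x"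
proof -
  have "x \<oplus> (-1::complex) \<odot> x = \<zero>"
    by (rule add_neg[OF x])
  then have "0 \<le> q x + q ((-1::complex) \<odot> x)"
    using sublinear_scale[OF q _ x, of 0] sublinear_add[OF q x scale_closed[OF x, of "-1"]] x
    by (simp add: scale_zero)
  then show ?thesis by simp
qed

text \<open>
  The largest sublinear function below \<open>q\<close> whose value at \<open>-y\<close> is at most \<open>-q y\<close>. A minimal \<open>q\<close>
  equals its own straightening, and \<open>straighten_add_le\<close> then makes it superadditive, hence additive.
  Straightening the norm at a point \<open>a\<close> forces every linear function below to attain the norm of
  \<open>a\<close> there.
\<close>

definition straighten :: "('v \<Rightarrow> real) \<Rightarrow> 'v \<Rightarrow> 'v \<Rightarrow> real" where
  "straighten q y = (\<lambda>x\<in>carrier V. INF t\<in>{0..}. q (x \<oplus> complex_of_real t \<odot> y) - t * q y)"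

context
  fixes q y
  assumes q: "q \<in> dominated_sublinear" and y: "y \<in> carrier V"
begin

lemma straighten_bdd:
  assumes x: "x \<in> carrier V"
  shows "bdd_below ((\<lambda>t. q (x \<oplus> complex_of_real t \<odot> y) - t * q y) ` {0..})"
proof (rule bdd_belowI2)
  fix t :: real assume "t \<in> {0..}"
  then have t: "t \<ge> 0" by simp
  let ?n = "(-1::complex) \<odot> x" and ?ty = "complex_of_real t \<odot> y"
  have cl: "?n \<in> carrier V" "?ty \<in> carrier V" using x y by (auto simp: scale_closed)
  have "?n \<oplus> x = \<zero>"
    by (rule neg_add[OF x])
  then have "?ty = ?n \<oplus> (x \<oplus> ?ty)"
    using cl x by (simp flip: M.a_assoc)
  then have "t * q y \<le> q ?n + q (x \<oplus> ?ty)"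
    using sublinear_add[OF q cl(1), of "x \<oplus> ?ty"] cl x sublinear_scale[OF q t y] by simp
  then show "- q ?n \<le> q (x \<oplus> ?ty) - t * q y" by simp
qed

lemma straighten_le:
  assumes "x \<in> carrier V" "t \<ge> 0"
  shows "straighten q y x \<le> q (x \<oplus> complex_of_real t \<odot> y) - t * q y"
  using cINF_lower[OF straighten_bdd[OF assms(1)], of t] assms by (simp add: straighten_def)

lemma straighten_le_self: "x \<in> carrier V \<Longrightarrow> straighten q y x \<le> q x"
  using straighten_le[of x 0] y by (simp add: scale_zero)

lemma straighten_add_le: "x \<in> carrier V \<Longrightarrow> straighten q y x + q y \<le> q (x \<oplus> y)"
  using straighten_le[of x 1] y by (simp add: scale_one)

lemma straighten_sublinear: "straighten q y \<in> dominated_sublinear"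
proof -
  let ?s = "straighten q y"
  have greatest: "m \<le> ?s x"
    if "x \<in> carrier V" "\<And>t. t \<ge> 0 \<Longrightarrow> m \<le> q (x \<oplus> complex_of_real t \<odot> y) - t * q y" for x m
    using that by (auto simp: straighten_def intro!: cINF_greatest)
  have add: "?s (x \<oplus> z) \<le> ?s x + ?s z" if x: "x \<in> carrier V" and z: "z \<in> carrier V" for x z
  proof -
    have *: "?s (x \<oplus> z) - (q (z \<oplus> complex_of_real t \<odot> y) - t * q y)
        \<le> q (x \<oplus> complex_of_real r \<odot> y) - r * q y" if "r \<ge> 0" "t \<ge> 0" for r t
    proof -
      let ?r = "complex_of_real r \<odot> y" and ?t = "complex_of_real t \<odot> y"
      have cl: "?r \<in> carrier V" "?t \<in> carrier V" using y by (auto simp: scale_closed)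
      have "(x \<oplus> z) \<oplus> complex_of_real (r + t) \<odot> y = (x \<oplus> ?r) \<oplus> (z \<oplus> ?t)"
        using x z cl y by (simp add: scale_add_left M.a_ac)
      then show ?thesis
        using straighten_le[of "x \<oplus> z" "r + t"] sublinear_add[OF q, of "x \<oplus> ?r" "z \<oplus> ?t"] x z cl that
        by (simp add: algebra_simps)
    qed
    have "?s (x \<oplus> z) - (q (z \<oplus> complex_of_real t \<odot> y) - t * q y) \<le> ?s x" if "t \<ge> 0" for t
      using * that by (intro greatest x) auto
    then have "?s (x \<oplus> z) - ?s x \<le> ?s z"
      by (intro greatest z) (simp add: algebra_simps)
    then show ?thesis by simp
  qed
  have scale: "?s (complex_of_real r \<odot> x) \<le> r * ?s x" if r: "r > 0" and x: "x \<in> carrier V" for r x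
  proof -
    have "?s (complex_of_real r \<odot> x) / r \<le> ?s x"
    proof (rule greatest[OF x])
      fix t :: real assume t: "t \<ge> 0"
      let ?t = "complex_of_real t \<odot> y"
      have "complex_of_real r \<odot> x \<oplus> complex_of_real (r * t) \<odot> y = complex_of_real r \<odot> (x \<oplus> ?t)"
        using x y by (simp add: scale_add_right scale_scale scale_closed)
      then have "?s (complex_of_real r \<odot> x) \<le> r * q (x \<oplus> ?t) - r * t * q y"
        using straighten_le[of "complex_of_real r \<odot> x" "r * t"] r t x y
          sublinear_scale[OF q, of r "x \<oplus> ?t"] by (simp add: scale_closed)
      also have "\<dots> = r * (q (x \<oplus> ?t) - t * q y)" by (simp add: algebra_simps)
      finally show "?s (complex_of_real r \<odot> x) / r \<le> q (x \<oplus> ?t) - t * q y"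
        using r by (simp add: pos_divide_le_eq mult.commute)
    qed
    then show ?thesis using r by (simp add: pos_divide_le_eq mult.commute)
  qed
  have "?s \<in> extensional (carrier V)" by (simp add: straighten_def)
  moreover have "?s x \<le> nrm V x" if "x \<in> carrier V" for x
    using straighten_le_self[OF that] sublinear_dominated[OF q that] by simp
  ultimately show ?thesis
    using add scale by (simp add: dominated_sublinear_def)
qed

end

lemma nrm_sublinear: "(\<lambda>x\<in>carrier V. nrm V x) \<in> dominated_sublinear"
  by (auto simp: dominated_sublinear_def nrm_triangle nrm_smult scale_closed)

text \<open>
  Zorn's lemma, with pointwise infima of chains. The infimum is finite because every sublinear
  function below the norm is also above minus the norm, and it is subadditive because of two
  members of a chain one lies below the other.
\<close>

lemma minimal_sublinear:
  assumes q0: "q0 \<in> dominated_sublinear"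
  obtains q where "q \<in> dominated_sublinear" "\<And>x. x \<in> carrier V \<Longrightarrow> q x \<le> q0 x"
    "\<And>r. \<lbrakk>r \<in> dominated_sublinear; \<And>x. x \<in> carrier V \<Longrightarrow> r x \<le> q x\<rbrakk> \<Longrightarrow> r = q"
proof -
  define S where "S = {q \<in> dominated_sublinear. \<forall>x\<in>carrier V. q x \<le> q0 x}"
  define below where "below q r \<longleftrightarrow> (\<forall>x\<in>carrier V. r x \<le> q x)" for q r :: "'v \<Rightarrow> real"
  have "\<exists>m\<in>S. \<forall>a\<in>S. below m a \<longrightarrow> a = m"
  proof (rule predicate_Zorn)
    have antisym: "q = r" if "q \<in> S" "r \<in> S" "below q r" "below r q" for q r
    proof (rule extensionalityI)
      show "q \<in> extensional (carrier V)" "r \<in> extensional (carrier V)"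
        using that(1,2) sublinear_extensional by (auto simp: S_def)
      show "q x = r x" if "x \<in> carrier V" for x
        using \<open>below q r\<close> \<open>below r q\<close> that by (force simp: below_def)
    qed
    show "partial_order_on S (relation_of below S)"
    proof (rule partial_order_on_relation_ofI)
      show "below q q" for q by (simp add: below_def)
      show "below q s" if "below q r" "below r s" for q r s
        using that by (force simp: below_def)
      show "q = r" if "q \<in> S" "r \<in> S" "below q r" "below r q" for q r
        by (rule antisym[OF that])
    qed
  next
    fix C assume C: "C \<in> Chains (relation_of below S)"
    then have C_S: "C \<subseteq> S" by (auto simp: Chains_def relation_of_def)
    have total: "below q r \<or> below r q" if "q \<in> C" "r \<in> C" for q r
      using C that unfolding Chains_def relation_of_def by auto
    show "\<exists>u\<in>S. \<forall>q\<in>C. below q u"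
    proof (cases "C = {}")
      case True
      then show ?thesis using q0 by (auto simp: S_def)
    next
      case False
      define u where "u = (\<lambda>x\<in>carrier V. INF q\<in>C. q x)"
      have C_sub: "q \<in> dominated_sublinear" if "q \<in> C" for q
        using that C_S by (auto simp: S_def)
      have lower: "- nrm V x \<le> q x" if "q \<in> C" "x \<in> carrier V" for q x
        using sublinear_lower[OF C_sub[OF that(1)] that(2)]
          sublinear_dominated[OF C_sub[OF that(1)] scale_closed[OF that(2), of "-1"]] that(2)
        by (simp add: nrm_smult)
      have u_le: "u x \<le> q x" if "q \<in> C" "x \<in> carrier V" for q x
      proof -
        have "bdd_below ((\<lambda>q. q x) ` C)"
          using lower that(2) by (intro bdd_belowI2[of _ "- nrm V x"]) auto
        then show ?thesis using cINF_lower[of "\<lambda>q. q x" C q] that by (simp add: u_def)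
      qed
      have u_greatest: "m \<le> u x" if "x \<in> carrier V" "\<And>q. q \<in> C \<Longrightarrow> m \<le> q x" for m x
        using that False by (auto simp: u_def intro!: cINF_greatest)
      have add: "u (x \<oplus> y) \<le> u x + u y" if x: "x \<in> carrier V" and y: "y \<in> carrier V" for x y
      proof -
        have *: "u (x \<oplus> y) - r y \<le> q x" if q: "q \<in> C" and r: "r \<in> C" for q r
        proof -
          obtain s where s: "s \<in> C" "s x \<le> q x" "s y \<le> r y"
            using total[OF q r] x y q r by (auto simp: below_def)
          then show ?thesis
            using u_le[OF s(1), of "x \<oplus> y"] sublinear_add[OF C_sub[OF s(1)] x y] x y by simp
        qed
        have "u (x \<oplus> y) - r y \<le> u x" if "r \<in> C" for r
          using * that by (intro u_greatest x)
        then have "u (x \<oplus> y) - u x \<le> u y"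
          by (intro u_greatest y) (simp add: algebra_simps)
        then show ?thesis by simp
      qed
      have scale: "u (complex_of_real t \<odot> x) \<le> t * u x" if t: "t > 0" and x: "x \<in> carrier V" for t x
      proof -
        have "u (complex_of_real t \<odot> x) / t \<le> q x" if "q \<in> C" for q
          using u_le[OF that scale_closed[OF x, of "complex_of_real t"]]
            sublinear_scale_le[OF C_sub[OF that] t x] t
          by (simp add: pos_divide_le_eq mult.commute)
        then have "u (complex_of_real t \<odot> x) / t \<le> u x" by (rule u_greatest[OF x])
        then show ?thesis using t by (simp add: pos_divide_le_eq mult.commute)
      qed
      obtain q where q: "q \<in> C" using False by blast
      have "u x \<le> nrm V x" "u x \<le> q0 x" if "x \<in> carrier V" for x
        using u_le[OF q that] sublinear_dominated[OF C_sub[OF q] that] q C_S that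
        by (force simp: S_def)+
      moreover have "u \<in> extensional (carrier V)" by (simp add: u_def)
      ultimately have "u \<in> S"
        using add scale by (simp add: S_def dominated_sublinear_def)
      then show ?thesis using u_le by (auto simp: below_def)
    qed
  qed
  then obtain m where m: "m \<in> S" and minimal: "\<And>a. a \<in> S \<Longrightarrow> below m a \<Longrightarrow> a = m" by blast
  show ?thesis
  proof (rule that)
    show "m \<in> dominated_sublinear" using m by (simp add: S_def)
    show "m x \<le> q0 x" if "x \<in> carrier V" for x using m that by (simp add: S_def)
    show "r = m" if "r \<in> dominated_sublinear" "\<And>x. x \<in> carrier V \<Longrightarrow> r x \<le> m x" for r
    proof (rule minimal)
      show "below m r" using that(2) by (simp add: below_def)
      show "r \<in> S" using m that by (force simp: S_def)
    qed
  qed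
qed

text \<open>
  Let \<open>q\<close> be minimal below the straightening of the norm at \<open>a\<close>. It is real linear, and
  \<open>q (-a) \<le> -\<parallel>a\<parallel>\<close> yields \<open>q a \<ge> \<parallel>a\<parallel>\<close>. The function \<open>q x - \<i> q (\<i> x)\<close> is its complex linear companion.
\<close>

theorem norming_functional:
  assumes a: "a \<in> carrier V"
  obtains f where "f \<in> carrier (dual V)" "nrm (dual V) f \<le> 1" "nrm V a \<le> cmod (f a)"
proof -
  let ?nrm = "\<lambda>x\<in>carrier V. nrm V x"
  obtain q where q: "q \<in> dominated_sublinear"
    and below: "\<And>x. x \<in> carrier V \<Longrightarrow> q x \<le> straighten ?nrm a x"
    and minimal: "\<And>r. \<lbrakk>r \<in> dominated_sublinear; \<And>x. x \<in> carrier V \<Longrightarrow> r x \<le> q x\<rbrakk> \<Longrightarrow> r = q"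
    using minimal_sublinear[OF straighten_sublinear[OF nrm_sublinear a]] by blast
  have add: "q (x \<oplus> y) = q x + q y" if x: "x \<in> carrier V" and y: "y \<in> carrier V" for x y
  proof -
    have "straighten q y = q"
      by (intro minimal straighten_sublinear straighten_le_self q y)
    then show ?thesis
      using straighten_add_le[OF q y x] sublinear_add[OF q x y] by simp
  qed
  have neg: "q ((-1::complex) \<odot> x) = - q x" if x: "x \<in> carrier V" for x
  proof -
    have "x \<oplus> (-1::complex) \<odot> x = \<zero>"
      by (rule add_neg[OF x])
    then have "q x + q ((-1::complex) \<odot> x) = q (complex_of_real 0 \<odot> x)"
      using add[OF x scale_closed[OF x, of "-1"]] x by (simp add: scale_zero)
    then show ?thesis using sublinear_scale[OF q _ x, of 0] by simp
  qed
  have scale: "q (complex_of_real t \<odot> x) = t * q x" if x: "x \<in> carrier V" for t x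
  proof (cases "t \<ge> 0")
    case True
    then show ?thesis by (rule sublinear_scale[OF q _ x])
  next
    case False
    have "complex_of_real t \<odot> x = (-1::complex) \<odot> (complex_of_real (- t) \<odot> x)"
      using x by (simp add: scale_scale)
    then have "q (complex_of_real t \<odot> x) = - q (complex_of_real (- t) \<odot> x)"
      using neg[OF scale_closed[OF x]] by simp
    then show ?thesis using sublinear_scale[OF q _ x, of "- t"] False by simp
  qed
  have cscale: "q (c \<odot> x) = Re c * q x + Im c * q (\<i> \<odot> x)" if x: "x \<in> carrier V" for c x
  proof -
    have "c \<odot> x = complex_of_real (Re c) \<odot> x \<oplus> complex_of_real (Im c) \<odot> (\<i> \<odot> x)"
      using scale_add_left[OF x, of "complex_of_real (Re c)" "complex_of_real (Im c) * \<i>"] x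
      by (simp add: scale_scale flip: complex_eq) (simp add: complex_eq[symmetric] mult.commute)
    then show ?thesis using x add scale by (simp add: scale_closed)
  qed
  define f where "f = (\<lambda>x\<in>carrier V. Complex (q x) (- q (\<i> \<odot> x)))"
  have f_add: "f (x \<oplus> y) = f x + f y" if "x \<in> carrier V" "y \<in> carrier V" for x y
    using that by (simp add: f_def add scale_add_right scale_closed complex_eq_iff)
  have f_scale: "f (c \<odot> x) = c * f x" if x: "x \<in> carrier V" for c x
  proof -
    have "q (\<i> \<odot> (c \<odot> x)) = Re c * q (\<i> \<odot> x) - Im c * q x"
      using cscale[OF x, of "\<i> * c"] x by (simp add: scale_scale)
    then show ?thesis
      using x cscale[OF x, of c] by (simp add: f_def scale_closed complex_eq_iff algebra_simps)
  qed
  have f_bound: "cmod (f x) \<le> 1 * nrm V x" if x: "x \<in> carrier V" for x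
  proof (cases "f x = 0")
    case True
    then show ?thesis using nrm_nonneg[OF x] by simp
  next
    case False
    \<comment> \<open>Rotate the value of the functional onto the positive real axis, where it is a value of \<open>q\<close>.\<close>
    define w where "w = cnj (f x) / cmod (f x)"
    have w: "cmod w = 1" "w * f x = cmod (f x)"
      using False by (auto simp: w_def norm_divide complex_norm_square[symmetric] power2_eq_square mult.commute[of "cnj _"])
    have "cmod (f x) = Re (f (w \<odot> x))" using x w by (simp add: f_scale)
    also have "\<dots> = q (w \<odot> x)" using x by (simp add: f_def scale_closed)
    also have "\<dots> \<le> nrm V (w \<odot> x)" by (intro sublinear_dominated q scale_closed x)
    finally show ?thesis using x w by (simp add: nrm_smult)
  qed
  have "q ((-1::complex) \<odot> a) \<le> - nrm V a"
  proof -
    have "(-1::complex) \<odot> a \<oplus> a = \<zero>"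
      by (rule neg_add[OF a])
    then show ?thesis
      using below[OF scale_closed[OF a, of "-1"]] straighten_add_le[OF nrm_sublinear a scale_closed[OF a, of "-1"]]
        a by (simp add: nrm_zero)
  qed
  then have "nrm V a \<le> Re (f a)" using neg[OF a] a by (simp add: f_def)
  then have "nrm V a \<le> cmod (f a)" using complex_Re_le_cmod order_trans by blast
  moreover have "f \<in> carrier (dual V)"
    using f_add f_scale f_bound by (intro dual_memI[where K = 1]) (auto simp: f_def)
  moreover have "nrm (dual V) f \<le> 1"
    using f_bound by (intro dual_nrm_leI) auto
  ultimately show ?thesis by (rule that[rotated -1])
qed

lemma embed_closed:
  assumes x: "x \<in> carrier V"
  shows "embed V x \<in> carrier (dual (dual V))"
proof (rule dual_memI)
  fix f assume f: "f \<in> carrier (dual V)"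
  show "cmod (embed V x f) \<le> nrm V x * nrm (dual V) f"
    using dual_bound[OF f x] f by (simp add: embed_def mult.commute)
qed (use x in \<open>auto simp: embed_def dual_simps dual_add_closed dual_scale_closed\<close>)

text \<open>
  The embedding into the bidual does not decrease norms: this is what makes the inverse of the
  embedding bounded once the embedding is onto.
\<close>

lemma nrm_le_nrm_embed:
  assumes x: "x \<in> carrier V"
  shows "nrm V x \<le> nrm (dual (dual V)) (embed V x)"
proof -
  interpret D: complex_normed_space "dual V" by (rule complex_normed_space_dual)
  obtain f where f: "f \<in> carrier (dual V)" "nrm (dual V) f \<le> 1" "nrm V x \<le> cmod (f x)"
    using norming_functional[OF x] by blast
  have "cmod (f x) \<le> nrm (dual (dual V)) (embed V x) * nrm (dual V) f"
    using D.dual_bound[OF embed_closed[OF x] f(1)] f(1) by (simp add: embed_def)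
  also have "\<dots> \<le> nrm (dual (dual V)) (embed V x) * 1"
    by (intro mult_left_mono f(2) D.dual_nrm_nonneg embed_closed x)
  finally show ?thesis using f(3) by simp
qed

end

section \<open>The bidual as a Banach algebra acting on the dual\<close>

context banach_algebra
begin

lemma bidual_simps:
  "carrier (bidual A) = carrier (dual (dual A))"
  "nrm (bidual A) = nrm (dual (dual A))"
  "\<zero>\<^bsub>bidual A\<^esub> = \<zero>\<^bsub>dual (dual A)\<^esub>"
  "p \<oplus>\<^bsub>bidual A\<^esub> q = p \<oplus>\<^bsub>dual (dual A)\<^esub> q"
  "c \<odot>\<^bsub>bidual A\<^esub> p = c \<odot>\<^bsub>dual (dual A)\<^esub> p"
  "p \<otimes>\<^bsub>bidual A\<^esub> q = arens1 A p q"
  by (simp_all add: bidual_def)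

lemma banach_space_bidual: "banach_space (bidual A)"
proof -
  interpret D: complex_normed_space "dual A" by (rule complex_normed_space_dual)
  show ?thesis
    by (rule banach_space_isometric_copy[OF D.banach_space_dual, where h = "\<lambda>p. p"])
      (auto simp: bidual_simps bij_betw_def)
qed

lemma bidual_norm_bound:
  assumes "p \<in> carrier (bidual A)" "f \<in> carrier (dual A)"
  shows "cmod (p f) \<le> nrm (bidual A) p * nrm (dual A) f"
proof -
  interpret D: complex_normed_space "dual A" by (rule complex_normed_space_dual)
  show ?thesis using D.dual_bound assms by (simp add: bidual_simps)
qed

lemma bidual_nrm_nonneg: "p \<in> carrier (bidual A) \<Longrightarrow> 0 \<le> nrm (bidual A) p"
proof -
  interpret D: complex_normed_space "dual A" by (rule complex_normed_space_dual)
  show "p \<in> carrier (bidual A) \<Longrightarrow> ?thesis" using D.dual_nrm_nonneg by (simp add: bidual_simps)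
qed

lemma nrm_translate_left:
  assumes f: "f \<in> carrier (dual A)" and a: "a \<in> carrier A"
  shows "nrm (dual A) (\<lambda>b\<in>carrier A. f (a \<otimes> b)) \<le> nrm (dual A) f * nrm A a"
proof (rule dual_nrm_leI)
  fix b assume b: "b \<in> carrier A"
  have "cmod (f (a \<otimes> b)) \<le> nrm (dual A) f * nrm A (a \<otimes> b)"
    by (intro dual_bound f mult_closed a b)
  also have "\<dots> \<le> nrm (dual A) f * (nrm A a * nrm A b)"
    by (intro mult_left_mono nrm_mult a b dual_nrm_nonneg f)
  finally show "cmod ((\<lambda>b\<in>carrier A. f (a \<otimes> b)) b) \<le> nrm (dual A) f * nrm A a * nrm A b"
    using b by (simp add: mult.assoc)
qed (use dual_nrm_nonneg[OF f] nrm_nonneg[OF a] in simp)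

lemma nrm_translate_right:
  assumes f: "f \<in> carrier (dual A)" and a: "a \<in> carrier A"
  shows "nrm (dual A) (\<lambda>b\<in>carrier A. f (b \<otimes> a)) \<le> nrm (dual A) f * nrm A a"
proof (rule dual_nrm_leI)
  fix b assume b: "b \<in> carrier A"
  have "cmod (f (b \<otimes> a)) \<le> nrm (dual A) f * nrm A (b \<otimes> a)"
    by (intro dual_bound f mult_closed a b)
  also have "\<dots> \<le> nrm (dual A) f * (nrm A b * nrm A a)"
    by (intro mult_left_mono nrm_mult a b dual_nrm_nonneg f)
  finally show "cmod ((\<lambda>b\<in>carrier A. f (b \<otimes> a)) b) \<le> nrm (dual A) f * nrm A a * nrm A b"
    using b by (simp add: mult_ac)
qed (use dual_nrm_nonneg[OF f] nrm_nonneg[OF a] in simp)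

lemma nrm_functional_left:
  assumes p: "p \<in> carrier (bidual A)" and f: "f \<in> carrier (dual A)"
  shows "nrm (dual A) (functional_left A p f) \<le> nrm (bidual A) p * nrm (dual A) f"
proof (rule dual_nrm_leI)
  fix a assume a: "a \<in> carrier A"
  have "cmod (functional_left A p f a) \<le> nrm (bidual A) p * nrm (dual A) (\<lambda>b\<in>carrier A. f (a \<otimes> b))"
    using bidual_norm_bound[OF p translate_left_functional[OF f a]] a by (simp add: functional_left_def)
  also have "\<dots> \<le> nrm (bidual A) p * (nrm (dual A) f * nrm A a)"
    by (intro mult_left_mono nrm_translate_left f a bidual_nrm_nonneg p)
  finally show "cmod (functional_left A p f a) \<le> nrm (bidual A) p * nrm (dual A) f * nrm A a"
    by (simp add: mult.assoc)
qed (use dual_nrm_nonneg[OF f] bidual_nrm_nonneg[OF p] in simp)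

lemma nrm_functional_right:
  assumes p: "p \<in> carrier (bidual A)" and f: "f \<in> carrier (dual A)"
  shows "nrm (dual A) (functional_right A f p) \<le> nrm (bidual A) p * nrm (dual A) f"
proof (rule dual_nrm_leI)
  fix a assume a: "a \<in> carrier A"
  have "cmod (functional_right A f p a) \<le> nrm (bidual A) p * nrm (dual A) (\<lambda>b\<in>carrier A. f (b \<otimes> a))"
    using bidual_norm_bound[OF p translate_right_functional[OF f a]] a by (simp add: functional_right_def)
  also have "\<dots> \<le> nrm (bidual A) p * (nrm (dual A) f * nrm A a)"
    by (intro mult_left_mono nrm_translate_right f a bidual_nrm_nonneg p)
  finally show "cmod (functional_right A f p a) \<le> nrm (bidual A) p * nrm (dual A) f * nrm A a"
    by (simp add: mult.assoc)
qed (use dual_nrm_nonneg[OF f] bidual_nrm_nonneg[OF p] in simp)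

lemma functional_left_add:
  assumes p: "p \<in> carrier (bidual A)" and f: "f \<in> carrier (dual A)" and g: "g \<in> carrier (dual A)"
  shows "functional_left A p (f \<oplus>\<^bsub>dual A\<^esub> g) = functional_left A p f \<oplus>\<^bsub>dual A\<^esub> functional_left A p g"
proof -
  have "p (\<lambda>b\<in>carrier A. (f \<oplus>\<^bsub>dual A\<^esub> g) (a \<otimes> b))
      = p (\<lambda>b\<in>carrier A. f (a \<otimes> b)) + p (\<lambda>b\<in>carrier A. g (a \<otimes> b))" if a: "a \<in> carrier A" for a
    using bidual_add[OF p translate_left_functional[OF f a] translate_left_functional[OF g a]] a
    by (simp add: dual_simps mult_closed cong: restrict_cong)
  then show ?thesis by (auto simp: functional_left_def dual_simps(2)[of A "restrict _ _"])
qed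

lemma functional_right_add:
  assumes p: "p \<in> carrier (bidual A)" and f: "f \<in> carrier (dual A)" and g: "g \<in> carrier (dual A)"
  shows "functional_right A (f \<oplus>\<^bsub>dual A\<^esub> g) p = functional_right A f p \<oplus>\<^bsub>dual A\<^esub> functional_right A g p"
proof -
  have "p (\<lambda>b\<in>carrier A. (f \<oplus>\<^bsub>dual A\<^esub> g) (b \<otimes> a))
      = p (\<lambda>b\<in>carrier A. f (b \<otimes> a)) + p (\<lambda>b\<in>carrier A. g (b \<otimes> a))" if a: "a \<in> carrier A" for a
    using bidual_add[OF p translate_right_functional[OF f a] translate_right_functional[OF g a]] a
    by (simp add: dual_simps mult_closed cong: restrict_cong)
  then show ?thesis by (auto simp: functional_right_def dual_simps(2)[of A "restrict _ _"])
qed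

lemma functional_left_scale:
  assumes p: "p \<in> carrier (bidual A)" and f: "f \<in> carrier (dual A)"
  shows "functional_left A p (c \<odot>\<^bsub>dual A\<^esub> f) = c \<odot>\<^bsub>dual A\<^esub> functional_left A p f"
proof -
  have "p (\<lambda>b\<in>carrier A. (c \<odot>\<^bsub>dual A\<^esub> f) (a \<otimes> b)) = c * p (\<lambda>b\<in>carrier A. f (a \<otimes> b))"
    if a: "a \<in> carrier A" for a
    using bidual_smult[OF p translate_left_functional[OF f a], of c] a
    by (simp add: dual_simps mult_closed cong: restrict_cong)
  then show ?thesis by (auto simp: functional_left_def dual_simps(3)[of A _ "restrict _ _"])
qed

lemma functional_right_scale:
  assumes p: "p \<in> carrier (bidual A)" and f: "f \<in> carrier (dual A)"
  shows "functional_right A (c \<odot>\<^bsub>dual A\<^esub> f) p = c \<odot>\<^bsub>dual A\<^esub> functional_right A f p"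
proof -
  have "p (\<lambda>b\<in>carrier A. (c \<odot>\<^bsub>dual A\<^esub> f) (b \<otimes> a)) = c * p (\<lambda>b\<in>carrier A. f (b \<otimes> a))"
    if a: "a \<in> carrier A" for a
    using bidual_smult[OF p translate_right_functional[OF f a], of c] a
    by (simp add: dual_simps mult_closed cong: restrict_cong)
  then show ?thesis by (auto simp: functional_right_def dual_simps(3)[of A _ "restrict _ _"])
qed

lemma functional_left_translate:
  assumes a: "a \<in> carrier A"
  shows "functional_left A p (\<lambda>b\<in>carrier A. f (a \<otimes> b)) = (\<lambda>b\<in>carrier A. functional_left A p f (a \<otimes> b))"
  using a by (auto simp: functional_left_def mult_closed mult_assoc fun_eq_iff
      intro!: arg_cong[of _ _ p])

lemma functional_right_translate:
  assumes a: "a \<in> carrier A"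
  shows "functional_right A (\<lambda>b\<in>carrier A. f (b \<otimes> a)) p = (\<lambda>b\<in>carrier A. functional_right A f p (b \<otimes> a))"
  using a by (auto simp: functional_right_def mult_closed mult_assoc fun_eq_iff
      intro!: arg_cong[of _ _ p])

lemma arens1_apply: "f \<in> carrier (dual A) \<Longrightarrow> arens1 A p q f = p (functional_left A q f)"
  by (simp add: arens1_def)

lemma functional_left_arens1:
  assumes q: "q \<in> carrier (bidual A)" and f: "f \<in> carrier (dual A)"
  shows "functional_left A (arens1 A p q) f = functional_left A p (functional_left A q f)"
proof -
  have "arens1 A p q (\<lambda>b\<in>carrier A. f (a \<otimes> b)) = p (\<lambda>b\<in>carrier A. functional_left A q f (a \<otimes> b))"
    if "a \<in> carrier A" for a
    using translate_left_functional[OF f that]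
    by (simp add: arens1_def functional_left_translate[OF that])
  then show ?thesis by (auto simp: functional_left_def[of A "arens1 A p q"] functional_left_def[of A p])
qed

lemma functional_right_arens2:
  assumes p: "p \<in> carrier (bidual A)" and f: "f \<in> carrier (dual A)"
  shows "functional_right A f (arens2 A p q) = functional_right A (functional_right A f p) q"
proof -
  have "arens2 A p q (\<lambda>b\<in>carrier A. f (b \<otimes> a)) = q (\<lambda>b\<in>carrier A. functional_right A f p (b \<otimes> a))"
    if "a \<in> carrier A" for a
    using translate_right_functional[OF f that]
    by (simp add: arens2_def functional_right_translate[OF that])
  then show ?thesis by (auto simp: functional_right_def[of A _ "arens2 A p q"] functional_right_def[of A _ q])
qed

lemma arens1_closed:
  assumes p: "p \<in> carrier (bidual A)" and q: "q \<in> carrier (bidual A)"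
  shows "arens1 A p q \<in> carrier (bidual A)"
    and "nrm (bidual A) (arens1 A p q) \<le> nrm (bidual A) p * nrm (bidual A) q"
proof -
  interpret D: complex_normed_space "dual A" by (rule complex_normed_space_dual)
  have bound: "cmod (arens1 A p q f) \<le> (nrm (bidual A) p * nrm (bidual A) q) * nrm (dual A) f"
    if f: "f \<in> carrier (dual A)" for f
  proof -
    have "cmod (arens1 A p q f) \<le> nrm (bidual A) p * nrm (dual A) (functional_left A q f)"
      using bidual_norm_bound[OF p functional_left_in_dual[OF q f]] f by (simp add: arens1_def)
    also have "\<dots> \<le> nrm (bidual A) p * (nrm (bidual A) q * nrm (dual A) f)"
      by (intro mult_left_mono nrm_functional_left q f bidual_nrm_nonneg p)
    finally show ?thesis by (simp add: mult.assoc)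
  qed
  have p': "p \<in> carrier (dual (dual A))" using p by (simp add: bidual_simps)
  show "arens1 A p q \<in> carrier (bidual A)"
    unfolding bidual_simps
    by (rule dual_memI[OF _ _ _ bound])
      (auto simp: arens1_def functional_left_add[OF q] functional_left_scale[OF q]
        functional_left_in_dual[OF q] dual_add[OF p'] dual_scale[OF p'] D.scale_closed extensional_def
        D.complex_normed_space_axioms intro: complex_normed_space.scale_closed)
  show "nrm (bidual A) (arens1 A p q) \<le> nrm (bidual A) p * nrm (bidual A) q"
    using D.dual_nrm_leI[OF _ bound] bidual_nrm_nonneg p q by (simp add: bidual_simps)
qed

lemma banach_algebra_bidual: "banach_algebra (bidual A)"
proof -
  interpret D: complex_normed_space "dual A" by (rule complex_normed_space_dual)
  interpret B: banach_space "bidual A" by (rule banach_space_bidual)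
  show ?thesis
  proof (intro banach_algebra.intro banach_algebra_axioms.intro banach_space_bidual)
    fix p q r assume p: "p \<in> carrier (bidual A)" and q: "q \<in> carrier (bidual A)"
      and r: "r \<in> carrier (bidual A)"
    have p': "p \<in> carrier (dual (dual A))" using p by (simp add: bidual_simps)
    show "p \<otimes>\<^bsub>bidual A\<^esub> q \<otimes>\<^bsub>bidual A\<^esub> r = p \<otimes>\<^bsub>bidual A\<^esub> (q \<otimes>\<^bsub>bidual A\<^esub> r)"
      unfolding bidual_simps(6)
    proof (rule extensionalityI)
      show "arens1 A (arens1 A p q) r f = arens1 A p (arens1 A q r) f" if "f \<in> carrier (dual A)" for f
        using that by (simp add: arens1_apply functional_left_arens1[OF r] functional_left_in_dual[OF r])
    qed (simp_all add: arens1_def)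
    show "(p \<oplus>\<^bsub>bidual A\<^esub> q) \<otimes>\<^bsub>bidual A\<^esub> r = p \<otimes>\<^bsub>bidual A\<^esub> r \<oplus>\<^bsub>bidual A\<^esub> q \<otimes>\<^bsub>bidual A\<^esub> r"
      by (auto simp: bidual_simps dual_simps arens1_def functional_left_in_dual[OF r])
    have "functional_left A (q \<oplus>\<^bsub>bidual A\<^esub> r) f = functional_left A q f \<oplus>\<^bsub>dual A\<^esub> functional_left A r f"
      if "f \<in> carrier (dual A)" for f
      using translate_left_functional[OF that]
      by (auto simp: bidual_simps dual_simps functional_left_def)
    then show "p \<otimes>\<^bsub>bidual A\<^esub> (q \<oplus>\<^bsub>bidual A\<^esub> r) = p \<otimes>\<^bsub>bidual A\<^esub> q \<oplus>\<^bsub>bidual A\<^esub> p \<otimes>\<^bsub>bidual A\<^esub> r"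
      using functional_left_in_dual[OF q] functional_left_in_dual[OF r]
      by (auto simp: bidual_simps dual_simps(2)[of "dual A"] arens1_def dual_add[OF p'])
  next
    fix p q c assume p: "p \<in> carrier (bidual A)" and q: "q \<in> carrier (bidual A)"
    have p': "p \<in> carrier (dual (dual A))" using p by (simp add: bidual_simps)
    show "(c \<odot>\<^bsub>bidual A\<^esub> p) \<otimes>\<^bsub>bidual A\<^esub> q = c \<odot>\<^bsub>bidual A\<^esub> (p \<otimes>\<^bsub>bidual A\<^esub> q)"
      by (auto simp: bidual_simps dual_simps arens1_def functional_left_in_dual[OF q])
    have "functional_left A (c \<odot>\<^bsub>bidual A\<^esub> q) f = c \<odot>\<^bsub>dual A\<^esub> functional_left A q f"
      if "f \<in> carrier (dual A)" for f
      using translate_left_functional[OF that]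
      by (auto simp: bidual_simps dual_simps functional_left_def)
    then show "p \<otimes>\<^bsub>bidual A\<^esub> (c \<odot>\<^bsub>bidual A\<^esub> q) = c \<odot>\<^bsub>bidual A\<^esub> (p \<otimes>\<^bsub>bidual A\<^esub> q)"
      using functional_left_in_dual[OF q]
      by (auto simp: bidual_simps dual_simps(3)[of "dual A"] arens1_def dual_scale[OF p'])
  qed (use arens1_closed in \<open>auto simp: bidual_simps(6)\<close>)
qed

text \<open>
  The dual of \<open>A\<close>, with the actions that define the two Arens products.
\<close>

definition dual_as_bidual_module ::
    "((('a \<Rightarrow> complex) \<Rightarrow> complex), 'a \<Rightarrow> complex) bimodule" where
  "dual_as_bidual_module =
     normed_space.extend (dual A) (bimodule.fields (functional_left A) (functional_right A))"

lemma dual_as_bidual_module_simps: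
  "carrier dual_as_bidual_module = carrier (dual A)"
  "\<zero>\<^bsub>dual_as_bidual_module\<^esub> = \<zero>\<^bsub>dual A\<^esub>"
  "f \<oplus>\<^bsub>dual_as_bidual_module\<^esub> g = f \<oplus>\<^bsub>dual A\<^esub> g"
  "c \<odot>\<^bsub>dual_as_bidual_module\<^esub> f = c \<odot>\<^bsub>dual A\<^esub> f"
  "nrm dual_as_bidual_module = nrm (dual A)"
  "lact dual_as_bidual_module = functional_left A"
  "ract dual_as_bidual_module = functional_right A"
  by (simp_all add: dual_as_bidual_module_def normed_space.defs bimodule.defs)

lemma embed_bidual: "a \<in> carrier A \<Longrightarrow> embed A a \<in> carrier (bidual A)"
  by (simp add: bidual_simps embed_closed)

lemma arens1_embed_left:
  assumes "a \<in> carrier A" "p \<in> carrier (bidual A)" "f \<in> carrier (dual A)"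
  shows "arens1 A (embed A a) p f = p (\<lambda>b\<in>carrier A. f (a \<otimes> b))"
  using functional_left_in_dual[OF assms(2,3)] assms
  by (simp add: arens1_def embed_def functional_left_def)

text \<open>
  The bimodule law \<open>(p.f).q = p.(f.q)\<close>. Evaluated at \<open>a\<close>, the two sides are
  \<open>q (\<lambda>b. p (\<lambda>c. f (b a c)))\<close> and \<open>p (\<lambda>c. q (\<lambda>b. f (b a c)))\<close>. Absorbing \<open>a\<close> into \<open>p\<close>, that is,
  passing to \<open>p' = a p\<close>, turns them into the two Arens products of \<open>q\<close> and \<open>p'\<close> at \<open>f\<close>.
\<close>

lemma functional_left_right_commute:
  assumes regular: "arens_regular A"
    and p: "p \<in> carrier (bidual A)" and q: "q \<in> carrier (bidual A)" and f: "f \<in> carrier (dual A)"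
  shows "functional_right A (functional_left A p f) q = functional_left A p (functional_right A f q)"
proof -
  have "q (\<lambda>b\<in>carrier A. functional_left A p f (b \<otimes> a))
      = p (\<lambda>c\<in>carrier A. functional_right A f q (a \<otimes> c))" if a: "a \<in> carrier A" for a
  proof -
    define p' where "p' = arens1 A (embed A a) p"
    have p': "p' \<in> carrier (bidual A)"
      unfolding p'_def by (intro arens1_closed embed_bidual a p)
    have "functional_left A p' f b = functional_left A p f (b \<otimes> a)" if b: "b \<in> carrier A" for b
      using a b arens1_embed_left[OF a p translate_left_functional[OF f b]]
      by (simp add: p'_def functional_left_def mult_closed mult_assoc cong: restrict_cong)
    then have "functional_left A p' f = (\<lambda>b\<in>carrier A. functional_left A p f (b \<otimes> a))"
      by (auto simp: functional_left_def[of A p'] fun_eq_iff)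
    then have "q (\<lambda>b\<in>carrier A. functional_left A p f (b \<otimes> a)) = arens1 A q p' f"
      using f by (simp add: arens1_def)
    also have "\<dots> = arens2 A q p' f"
      using regular p' q by (simp add: arens_regular_def)
    also have "\<dots> = p (\<lambda>c\<in>carrier A. functional_right A f q (a \<otimes> c))"
      using f arens1_embed_left[OF a p functional_right_in_dual[OF q f]]
      by (simp add: arens2_def p'_def)
    finally show ?thesis .
  qed
  then show ?thesis
    by (auto simp: functional_right_def[of A _ q] functional_left_def[of A p])
qed

text \<open>
  Arens regularity enters twice: the right action is a priori multiplicative for the second Arens
  product only, and the two actions have to commute.
\<close>

lemma banach_bimodule_dual:
  assumes regular: "arens_regular A"
  shows "banach_bimodule (bidual A) dual_as_bidual_module"
proof -
  interpret B: banach_algebra "bidual A" by (rule banach_algebra_bidual)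
  interpret D: banach_space "dual A" by (rule banach_space_dual)
  have X: "banach_space dual_as_bidual_module"
    by (rule banach_space_isometric_copy[OF D.banach_space_axioms, where h = "\<lambda>p. p"])
      (auto simp: dual_as_bidual_module_simps bij_betw_def)
  show ?thesis
  proof (intro banach_bimodule.intro banach_bimodule_axioms.intro B.banach_algebra_axioms X;
      (unfold dual_as_bidual_module_simps)?)
    show "\<exists>K. \<forall>a\<in>carrier (bidual A). \<forall>x\<in>carrier (dual A).
        nrm (dual A) (functional_left A a x) \<le> K * nrm (bidual A) a * nrm (dual A) x"
      using nrm_functional_left by (intro exI[of _ 1]) simp
    show "\<exists>K. \<forall>a\<in>carrier (bidual A). \<forall>x\<in>carrier (dual A).
        nrm (dual A) (functional_right A x a) \<le> K * nrm (bidual A) a * nrm (dual A) x"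
      using nrm_functional_right by (intro exI[of _ 1]) simp
  next
    fix p q f assume p: "p \<in> carrier (bidual A)" and q: "q \<in> carrier (bidual A)"
      and f: "f \<in> carrier (dual A)"
    show "functional_left A (p \<oplus>\<^bsub>bidual A\<^esub> q) f = functional_left A p f \<oplus>\<^bsub>dual A\<^esub> functional_left A q f"
      using translate_left_functional[OF f] by (auto simp: bidual_simps dual_simps functional_left_def)
    show "functional_right A f (p \<oplus>\<^bsub>bidual A\<^esub> q) = functional_right A f p \<oplus>\<^bsub>dual A\<^esub> functional_right A f q"
      using translate_right_functional[OF f] by (auto simp: bidual_simps dual_simps functional_right_def)
    show "functional_left A (p \<otimes>\<^bsub>bidual A\<^esub> q) f = functional_left A p (functional_left A q f)"
      by (simp add: bidual_simps(6) functional_left_arens1[OF q f])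
    have "p \<otimes>\<^bsub>bidual A\<^esub> q = arens2 A p q"
      using regular p q by (simp add: bidual_simps(6) arens_regular_def)
    then show "functional_right A f (p \<otimes>\<^bsub>bidual A\<^esub> q) = functional_right A (functional_right A f p) q"
      by (simp add: functional_right_arens2[OF p f])
    show "functional_right A (functional_left A p f) q = functional_left A p (functional_right A f q)"
      by (rule functional_left_right_commute[OF regular p q f])
  next
    fix p f c assume p: "p \<in> carrier (bidual A)" and f: "f \<in> carrier (dual A)"
    show "functional_left A (c \<odot>\<^bsub>bidual A\<^esub> p) f = c \<odot>\<^bsub>dual A\<^esub> functional_left A p f"
      using translate_left_functional[OF f] by (auto simp: bidual_simps dual_simps functional_left_def)
    show "functional_right A f (c \<odot>\<^bsub>bidual A\<^esub> p) = c \<odot>\<^bsub>dual A\<^esub> functional_right A f p"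
      using translate_right_functional[OF f] by (auto simp: bidual_simps dual_simps functional_right_def)
  qed (fact functional_left_in_dual functional_right_in_dual functional_left_add functional_right_add
      functional_left_scale functional_right_scale)+
qed

end

section \<open>An identity element of the bidual\<close>

lemma (in complex_normed_space) dual_diff:
  assumes "f \<in> carrier (dual V)" "x \<in> carrier V" "y \<in> carrier V"
  shows "f (x \<ominus> y) = f x - f y"
  using assms by (simp add: minus_eq_scale dual_add dual_scale scale_closed)

text \<open>
  A weak* cluster point in the bidual, as in the Banach-Alaoglu theorem: evaluation maps a bounded
  filter into a product of closed discs, which is compact. Linearity of the cluster point follows
  since it holds for evaluations and each coordinate is a limit along a finer filter.
\<close>

lemma (in complex_normed_space) bounded_filter_clusters_in_bidual:
  assumes nontrivial: "F \<noteq> bot" and bounded: "\<forall>\<^sub>F e in F. e \<in> carrier V \<and> nrm V e \<le> K"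
  obtains p where "p \<in> carrier (dual (dual V))"
    "\<And>f l. \<lbrakk>f \<in> carrier (dual V); (f \<longlongrightarrow> l) F\<rbrakk> \<Longrightarrow> p f = l"
proof -
  define S where "S f = (if f \<in> carrier (dual V) then cball (0::complex) (nrm (dual V) f * K) else {undefined})" for f
  define \<Phi> where "\<Phi> e = (\<lambda>f\<in>carrier (dual V). f e)" for e :: 'v
  define G where "G = filtermap \<Phi> F"
  have "compactin (product_topology (\<lambda>_. euclidean) UNIV) (PiE UNIV S)"
    by (auto simp: compactin_PiE S_def)
  then have compact: "compact (PiE UNIV S)" by (simp add: euclidean_product_topology)
  have "\<forall>\<^sub>F e in F. \<Phi> e \<in> PiE UNIV S"
    using bounded
  proof eventually_elim
    case (elim e)
    have "cmod (f e) \<le> nrm (dual V) f * K" if f: "f \<in> carrier (dual V)" for f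
      using dual_bound[OF f, of e] mult_left_mono[of "nrm V e" K, OF _ dual_nrm_nonneg[OF f]] elim
      by fastforce
    then show ?case by (auto simp: \<Phi>_def S_def)
  qed
  then have "\<forall>\<^sub>F \<phi> in G. \<phi> \<in> PiE UNIV S" by (simp add: G_def eventually_filtermap)
  moreover have "G \<noteq> bot" using nontrivial by (simp add: G_def filtermap_bot_iff)
  ultimately obtain p where p: "p \<in> PiE UNIV S" and cluster: "inf (nhds p) G \<noteq> bot"
    using compact unfolding compact_filter by blast
  \<comment> \<open>\<open>H\<close> refines \<open>G\<close> and converges to \<open>p\<close>, hence limits along \<open>G\<close> determine coordinates of \<open>p\<close>.\<close>
  define H where "H = inf (nhds p) G"
  have coordinate: "((\<lambda>\<phi>. \<phi> f) \<longlongrightarrow> p f) H" for f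
  proof -
    have "continuous_on UNIV (\<lambda>\<phi>::('v \<Rightarrow> complex) \<Rightarrow> complex. \<phi> f)" by simp
    then have "((\<lambda>\<phi>. \<phi> f) \<longlongrightarrow> p f) (at p)" unfolding continuous_on_def by simp
    then have "((\<lambda>\<phi>. \<phi> f) \<longlongrightarrow> p f) (nhds p)"
      by (rule tendsto_at_iff_tendsto_nhds[of "\<lambda>\<phi>. \<phi> f", THEN iffD1])
    then show ?thesis by (rule tendsto_mono[rotated]) (simp add: H_def)
  qed
  have limit: "p f = l" if "f \<in> carrier (dual V)" "((\<lambda>\<phi>. g \<phi>) \<longlongrightarrow> l) H" "\<forall>\<^sub>F \<phi> in G. \<phi> f = g \<phi>" for f g l
  proof -
    have "\<forall>\<^sub>F \<phi> in H. g \<phi> = \<phi> f"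
      using filter_leD[of H G, OF _ that(3)] by (auto simp: H_def elim: eventually_mono)
    then have "((\<lambda>\<phi>. \<phi> f) \<longlongrightarrow> l) H" using that(2) by (rule Lim_transform_eventually[rotated])
    then show ?thesis
      using cluster coordinate tendsto_unique unfolding H_def by blast
  qed
  have in_V: "\<forall>\<^sub>F e in F. e \<in> carrier V" using bounded by (rule eventually_mono) simp
  have "p \<in> carrier (dual (dual V))"
  proof (rule dual_memI)
    have "p f = undefined" if "f \<notin> carrier (dual V)" for f
      using PiE_mem[OF p, of f] that by (simp add: S_def)
    then show "p \<in> extensional (carrier (dual V))" by (simp add: extensional_def)
    fix f assume f: "f \<in> carrier (dual V)"
    show "cmod (p f) \<le> K * nrm (dual V) f"
      using PiE_mem[OF p, of f] f by (simp add: S_def mult.commute)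
    show "p (c \<odot>\<^bsub>dual V\<^esub> f) = c * p f" for c
    proof (rule limit)
      show "((\<lambda>\<phi>. c * \<phi> f) \<longlongrightarrow> c * p f) H" by (intro tendsto_intros coordinate)
      show "\<forall>\<^sub>F \<phi> in G. \<phi> (c \<odot>\<^bsub>dual V\<^esub> f) = c * \<phi> f"
        unfolding G_def eventually_filtermap using in_V
        by (rule eventually_mono) (use f dual_scale_closed[OF f] in \<open>simp add: \<Phi>_def dual_simps\<close>)
    qed (simp add: dual_simps dual_scale_closed[OF f])
    fix g assume g: "g \<in> carrier (dual V)"
    show "p (f \<oplus>\<^bsub>dual V\<^esub> g) = p f + p g"
    proof (rule limit)
      show "((\<lambda>\<phi>. \<phi> f + \<phi> g) \<longlongrightarrow> p f + p g) H" by (intro tendsto_intros coordinate)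
      show "\<forall>\<^sub>F \<phi> in G. \<phi> (f \<oplus>\<^bsub>dual V\<^esub> g) = \<phi> f + \<phi> g"
        unfolding G_def eventually_filtermap using in_V
        by (rule eventually_mono) (use f g dual_add_closed[OF f g] in \<open>simp add: \<Phi>_def dual_simps\<close>)
    qed (simp add: dual_simps dual_add_closed[OF f g])
  qed
  moreover have "p f = l" if f: "f \<in> carrier (dual V)" and l: "(f \<longlongrightarrow> l) F" for f l
  proof -
    have "((\<lambda>\<phi>. \<phi> f) \<longlongrightarrow> l) G"
      using l f by (simp add: G_def filterlim_filtermap \<Phi>_def)
    then have "((\<lambda>\<phi>. \<phi> f) \<longlongrightarrow> l) H" by (rule tendsto_mono[rotated]) (simp add: H_def)
    then show ?thesis using cluster coordinate tendsto_unique unfolding H_def by blast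
  qed
  ultimately show ?thesis by (rule that)
qed

context banach_algebra
begin

text \<open>
  A weak* cluster point \<open>E\<close> of the bounded approximate identity: \<open>(E.f)(a)\<close> is the limit of
  \<open>f (a e)\<close> and \<open>(f.E)(a)\<close> is the limit of \<open>f (e a)\<close>, both equal to \<open>f a\<close>.
\<close>

lemma bidual_identity_on_dual:
  assumes "has_bounded_approximate_identity A"
  obtains E where "E \<in> carrier (bidual A)"
    "\<And>f. f \<in> carrier (dual A) \<Longrightarrow> functional_left A E f = f"
    "\<And>f. f \<in> carrier (dual A) \<Longrightarrow> functional_right A f E = f"
proof -
  obtain F K where F: "F \<noteq> bot" and bounded: "\<forall>\<^sub>F e in F. e \<in> carrier A \<and> nrm A e \<le> K"
    and left: "\<And>a. a \<in> carrier A \<Longrightarrow> ((\<lambda>e. nrm A (e \<otimes> a \<ominus> a)) \<longlongrightarrow> 0) F"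
    and right: "\<And>a. a \<in> carrier A \<Longrightarrow> ((\<lambda>e. nrm A (a \<otimes> e \<ominus> a)) \<longlongrightarrow> 0) F"
    using assms unfolding has_bounded_approximate_identity_def by blast
  have in_A: "\<forall>\<^sub>F e in F. e \<in> carrier A" using bounded by (rule eventually_mono) simp
  obtain E where E: "E \<in> carrier (dual (dual A))"
    and limit: "\<And>f l. \<lbrakk>f \<in> carrier (dual A); (f \<longlongrightarrow> l) F\<rbrakk> \<Longrightarrow> E f = l"
    using bounded_filter_clusters_in_bidual[OF F bounded] by blast
  have conv: "(g \<longlongrightarrow> f a) F"
    if f: "f \<in> carrier (dual A)" and a: "a \<in> carrier A"
      and t: "\<And>e. e \<in> carrier A \<Longrightarrow> t e \<in> carrier A" "((\<lambda>e. nrm A (t e \<ominus> a)) \<longlongrightarrow> 0) F"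
      and g: "\<And>e. e \<in> carrier A \<Longrightarrow> g e = f (t e)" for f g t a
  proof -
    have "((\<lambda>e. nrm (dual A) f * nrm A (t e \<ominus> a)) \<longlongrightarrow> 0) F"
      by (rule tendsto_mult_right_zero[OF t(2)])
    moreover have "\<forall>\<^sub>F e in F. cmod (g e - f a) \<le> nrm (dual A) f * nrm A (t e \<ominus> a)"
      using in_A
    proof eventually_elim
      case (elim e)
      then show ?case
        using dual_bound[OF f, of "t e \<ominus> a"] t(1) a f by (simp add: g dual_diff)
    qed
    ultimately have "((\<lambda>e. g e - f a) \<longlongrightarrow> 0) F"
      by (rule Lim_null_comparison[rotated])
    then show ?thesis by (rule LIM_zero_cancel)
  qed
  show ?thesis
  proof (rule that)
    show "E \<in> carrier (bidual A)" using E by (simp add: bidual_simps)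
    fix f assume f: "f \<in> carrier (dual A)"
    have "E (\<lambda>b\<in>carrier A. f (a \<otimes> b)) = f a" if a: "a \<in> carrier A" for a
      by (rule limit[OF translate_left_functional[OF f a] conv[OF f a _ right[OF a]]])
        (use a in \<open>auto simp: mult_closed\<close>)
    then show "functional_left A E f = f"
      using dual_extensional[OF f] by (auto simp: functional_left_def fun_eq_iff extensional_def)
    have "E (\<lambda>b\<in>carrier A. f (b \<otimes> a)) = f a" if a: "a \<in> carrier A" for a
      by (rule limit[OF translate_right_functional[OF f a] conv[OF f a _ left[OF a]]])
        (use a in \<open>auto simp: mult_closed\<close>)
    then show "functional_right A f E = f"
      using dual_extensional[OF f] by (auto simp: functional_right_def fun_eq_iff extensional_def)
  qed
qed

lemma neo_unital_dual:
  assumes "has_bounded_approximate_identity A"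
  shows "neo_unital (bidual A) dual_as_bidual_module"
proof -
  obtain E where E: "E \<in> carrier (bidual A)"
    "\<And>f. f \<in> carrier (dual A) \<Longrightarrow> functional_left A E f = f"
    "\<And>f. f \<in> carrier (dual A) \<Longrightarrow> functional_right A f E = f"
    using bidual_identity_on_dual[OF assms] by blast
  have "\<exists>p f q. g = functional_left A p (functional_right A f q) \<and>
      p \<in> carrier (bidual A) \<and> f \<in> carrier (dual A) \<and> q \<in> carrier (bidual A)"
    if g: "g \<in> carrier (dual A)" for g
    by (intro exI[of _ E] exI[of _ g]) (simp add: E g)
  then show ?thesis
    unfolding neo_unital_def dual_as_bidual_module_simps
    using functional_left_in_dual functional_right_in_dual by blast
qed

end

section \<open>Copies of a module\<close>

lemma dual_module_simps:
  "carrier (dual_module X) = carrier (dual X)"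
  "\<zero>\<^bsub>dual_module X\<^esub> = \<zero>\<^bsub>dual X\<^esub>"
  "f \<oplus>\<^bsub>dual_module X\<^esub> g = f \<oplus>\<^bsub>dual X\<^esub> g"
  "c \<odot>\<^bsub>dual_module X\<^esub> f = c \<odot>\<^bsub>dual X\<^esub> f"
  "nrm (dual_module X) = nrm (dual X)"
  "lact (dual_module X) a f = (\<lambda>x\<in>carrier X. f (ract X x a))"
  "ract (dual_module X) f a = (\<lambda>x\<in>carrier X. f (lact X a x))"
  by (simp_all add: dual_module_def normed_space.defs bimodule.defs)

text \<open>
  The module \<open>X\<close> with its elements renamed along an injection \<open>h\<close>. It serves to place the dual of
  \<open>A\<close>, whose elements are functions on \<open>A\<close>, into a prescribed type.
\<close>

definition copy_module :: "('v \<Rightarrow> 'w) \<Rightarrow> ('b, 'v) bimodule \<Rightarrow> ('b, 'w) bimodule" where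
  "copy_module h X = (let g = inv_into (carrier X) h in
    \<lparr>carrier = h ` carrier X, monoid.mult = undefined, one = undefined,
     ring.zero = h \<zero>\<^bsub>X\<^esub>, add = (\<lambda>u v. h (g u \<oplus>\<^bsub>X\<^esub> g v)), smult = (\<lambda>c u. h (c \<odot>\<^bsub>X\<^esub> g u)),
     nrm = (\<lambda>u. nrm X (g u)), lact = (\<lambda>b u. h (lact X b (g u))), ract = (\<lambda>u b. h (ract X (g u) b))\<rparr>)"

lemma copy_module_simps:
  assumes "inj_on h (carrier X)"
  shows "carrier (copy_module h X) = h ` carrier X"
    and "\<zero>\<^bsub>copy_module h X\<^esub> = h \<zero>\<^bsub>X\<^esub>"
    and "\<lbrakk>x \<in> carrier X; y \<in> carrier X\<rbrakk> \<Longrightarrow> h x \<oplus>\<^bsub>copy_module h X\<^esub> h y = h (x \<oplus>\<^bsub>X\<^esub> y)"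
    and "x \<in> carrier X \<Longrightarrow> c \<odot>\<^bsub>copy_module h X\<^esub> h x = h (c \<odot>\<^bsub>X\<^esub> x)"
    and "x \<in> carrier X \<Longrightarrow> nrm (copy_module h X) (h x) = nrm X x"
    and "x \<in> carrier X \<Longrightarrow> lact (copy_module h X) b (h x) = h (lact X b x)"
    and "x \<in> carrier X \<Longrightarrow> ract (copy_module h X) (h x) b = h (ract X x b)"
  using assms by (simp_all add: copy_module_def Let_def)

lemma banach_bimodule_copy:
  assumes "banach_bimodule B X" and inj: "inj_on h (carrier X)"
  shows "banach_bimodule B (copy_module h X)"
proof -
  interpret banach_bimodule B X by fact
  note simps = copy_module_simps[OF inj]
  have "banach_space (copy_module h X)"
    by (rule banach_space_isometric_copy[OF X.banach_space_axioms, where h = h])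
      (auto simp: simps bij_betw_def inj)
  moreover have "\<exists>K. \<forall>a\<in>carrier B. \<forall>u\<in>h ` carrier X.
      nrm (copy_module h X) (lact (copy_module h X) a u) \<le> K * nrm B a * nrm (copy_module h X) u"
    using lact_bounded by (auto simp: simps lact_closed)
  moreover have "\<exists>K. \<forall>a\<in>carrier B. \<forall>u\<in>h ` carrier X.
      nrm (copy_module h X) (ract (copy_module h X) u a) \<le> K * nrm B a * nrm (copy_module h X) u"
    using ract_bounded by (auto simp: simps ract_closed)
  ultimately show ?thesis
    by (intro banach_bimodule.intro banach_bimodule_axioms.intro B.banach_algebra_axioms;
        (unfold simps(1), (elim imageE)?)?)
      (auto simp: simps X.scale_closed lact_closed ract_closed lact_add_left lact_add_right
        lact_smult_left lact_smult_right ract_add_left ract_add_right ract_smult_left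
        ract_smult_right lact_mult ract_mult lact_ract)
qed

lemma neo_unital_copy:
  assumes "banach_bimodule B X" and inj: "inj_on h (carrier X)" and "neo_unital B X"
  shows "neo_unital B (copy_module h X)"
proof -
  interpret banach_bimodule B X by fact
  note simps = copy_module_simps[OF inj]
  have "\<exists>a x b. y = lact X a (ract X x b) \<and> a \<in> carrier B \<and> x \<in> carrier X \<and> b \<in> carrier B"
    if "y \<in> carrier X" for y
    using \<open>neo_unital B X\<close> that unfolding neo_unital_def by blast
  then have "\<exists>a u b. h y = lact (copy_module h X) a (ract (copy_module h X) u b) \<and>
      a \<in> carrier B \<and> u \<in> h ` carrier X \<and> b \<in> carrier B" if "y \<in> carrier X" for y
    using that by (metis simps(6,7) ract_closed imageI)
  then show ?thesis
    unfolding neo_unital_def simps(1) by (auto simp: simps lact_closed ract_closed)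
qed

text \<open>
  Precomposition with the renaming turns functionals on the copy into functionals on \<open>X\<close> and
  commutes with the actions, so a factorization of the former gives one of the latter.
\<close>

lemma dual_factors_on_left_copyD:
  assumes "banach_bimodule (bidual A) X" and inj: "inj_on h (carrier X)"
    and factors: "dual_factors_on_left A (copy_module h X)"
    and embed: "\<And>a. a \<in> carrier A \<Longrightarrow> embed A a \<in> carrier (bidual A)"
    and F: "F \<in> carrier (dual X)"
  obtains a f where "a \<in> carrier A" "f \<in> carrier (dual X)"
    "F = lact (dual_module X) (embed A a) f"
proof -
  interpret banach_bimodule "bidual A" X by fact
  interpret Y: banach_bimodule "bidual A" "copy_module h X"
    by (rule banach_bimodule_copy) fact+
  note simps = copy_module_simps[OF inj]
  define G where "G = (\<lambda>u\<in>h ` carrier X. F (inv_into (carrier X) h u))"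
  have G: "G (h x) = F x" if "x \<in> carrier X" for x
    using that inj by (simp add: G_def)
  have "G \<in> carrier (dual (copy_module h X))"
  proof (rule dual_memI; (unfold simps(1), elim imageE)?)
    show "G \<in> extensional (carrier (copy_module h X))" by (simp add: G_def simps)
    show "cmod (G u) \<le> nrm (dual X) F * nrm (copy_module h X) u" if "u = h x" "x \<in> carrier X" for u x
      using X.dual_bound[OF F that(2)] that by (simp add: G simps)
  qed (auto simp: G simps X.scale_closed dual_add[OF F] dual_scale[OF F])
  then obtain a g where a: "a \<in> carrier A" and g: "g \<in> carrier (dual (copy_module h X))"
    and Gg: "G = (\<lambda>u\<in>h ` carrier X. g (ract (copy_module h X) u (embed A a)))"
    using factors unfolding dual_factors_on_left_def dual_module_simps simps(1) by blast
  define f where "f = (\<lambda>x\<in>carrier X. g (h x))"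
  have f: "f \<in> carrier (dual X)"
  proof (rule dual_memI)
    fix x assume x: "x \<in> carrier X"
    show "cmod (f x) \<le> nrm (dual (copy_module h X)) g * nrm X x"
      using Y.X.dual_bound[OF g, of "h x"] x by (simp add: f_def simps)
    show "f (c \<odot>\<^bsub>X\<^esub> x) = c * f x" for c
      using dual_scale[OF g, of "h x" c] x by (simp add: f_def simps X.scale_closed)
    fix y assume y: "y \<in> carrier X"
    show "f (x \<oplus>\<^bsub>X\<^esub> y) = f x + f y"
      using dual_add[OF g, of "h x" "h y"] x y by (simp add: f_def simps)
  qed (simp add: f_def)
  have "F = lact (dual_module X) (embed A a) f"
  proof (rule extensionalityI)
    show "F \<in> extensional (carrier X)" by (rule dual_extensional[OF F])
    show "F x = lact (dual_module X) (embed A a) f x" if x: "x \<in> carrier X" for x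
      using G[OF x] ract_closed[OF embed[OF a] x] x by (simp add: Gg dual_module_simps simps f_def)
  qed (simp add: dual_module_simps)
  with a f show ?thesis by (rule that)
qed

section \<open>The factorization hypothesis makes the algebra reflexive\<close>

text \<open>
  For the module \<open>X = A*\<close> the dual module is \<open>A**\<close>, on which \<open>a\<close> acts from the left by
  \<open>(a.p)(f) = p (f.a)\<close>. That is exactly multiplication by \<open>a\<close> for the first Arens product, so the
  factorization hypothesis for \<open>X\<close> reads \<open>A A** = A**\<close>.
\<close>

lemma (in banach_algebra) bidual_factors:
  fixes h :: "('a \<Rightarrow> complex) \<Rightarrow> 'u"
  assumes regular: "arens_regular A" and bai: "has_bounded_approximate_identity A" and inj: "inj h"
    and factors: "\<And>X :: (('a \<Rightarrow> complex) \<Rightarrow> complex, 'u) bimodule.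
      \<lbrakk>banach_bimodule (bidual A) X; neo_unital (bidual A) X\<rbrakk> \<Longrightarrow> dual_factors_on_left A X"
    and P: "P \<in> carrier (bidual A)"
  obtains a p where "a \<in> carrier A" "p \<in> carrier (bidual A)" "P = embed A a \<otimes>\<^bsub>bidual A\<^esub> p"
proof -
  have inj': "inj_on h (carrier dual_as_bidual_module)" using inj by (rule inj_on_subset) simp
  note mod = banach_bimodule_dual[OF regular]
  have "dual (dual_as_bidual_module) = dual (dual A)"
    by (simp add: dual_def[of dual_as_bidual_module] dual_def[of "dual A"] functionals_def
        dual_as_bidual_module_simps)
  then have carrier_dual: "carrier (dual dual_as_bidual_module) = carrier (bidual A)"
    by (simp add: bidual_simps)
  have "dual_factors_on_left A (copy_module h dual_as_bidual_module)"
    by (intro factors banach_bimodule_copy neo_unital_copy mod inj' neo_unital_dual bai)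
  then obtain a p where a: "a \<in> carrier A" and p: "p \<in> carrier (bidual A)"
    and P_eq: "P = lact (dual_module dual_as_bidual_module) (embed A a) p"
    using dual_factors_on_left_copyD[OF mod inj' _ embed_bidual] P
    unfolding carrier_dual by metis
  have "P = embed A a \<otimes>\<^bsub>bidual A\<^esub> p"
  proof (rule extensionalityI)
    show "P \<in> extensional (carrier (dual A))"
      using P by (intro dual_extensional) (simp add: bidual_simps)
    show "P f = (embed A a \<otimes>\<^bsub>bidual A\<^esub> p) f" if f: "f \<in> carrier (dual A)" for f
    proof -
      have "functional_right A f (embed A a) = (\<lambda>b\<in>carrier A. f (a \<otimes> b))"
        using a f translate_right_functional[OF f] by (auto simp: functional_right_def embed_def)
      then show ?thesis
        using f arens1_embed_left[OF a p f]
        by (simp add: P_eq dual_module_simps dual_as_bidual_module_simps bidual_simps(6))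
    qed
  qed (simp add: bidual_simps arens1_def)
  with a p show ?thesis by (rule that)
qed

text \<open>
  The right ideal property places \<open>A A**\<close>, which is all of \<open>A**\<close>, inside \<open>A\<close>.
\<close>

lemma (in banach_algebra) embed_surj:
  fixes h :: "('a \<Rightarrow> complex) \<Rightarrow> 'u"
  assumes "arens_regular A" "has_bounded_approximate_identity A" "inj h"
    and ideal: "right_ideal_of_bidual A"
    and "\<And>X :: (('a \<Rightarrow> complex) \<Rightarrow> complex, 'u) bimodule.
      \<lbrakk>banach_bimodule (bidual A) X; neo_unital (bidual A) X\<rbrakk> \<Longrightarrow> dual_factors_on_left A X"
  shows "embed A ` carrier A = carrier (bidual A)"
proof
  show "embed A ` carrier A \<subseteq> carrier (bidual A)" using embed_bidual by blast
  show "carrier (bidual A) \<subseteq> embed A ` carrier A"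
  proof
    fix P assume "P \<in> carrier (bidual A)"
    then obtain a p where "a \<in> carrier A" "p \<in> carrier (bidual A)" "P = embed A a \<otimes>\<^bsub>bidual A\<^esub> p"
      using bidual_factors[OF assms(1-3,5)] by metis
    then show "P \<in> embed A ` carrier A"
      using ideal by (simp add: right_ideal_of_bidual_def)
  qed
qed

section \<open>Restriction of scalars\<close>

definition restrict_scalars :: "('c \<Rightarrow> 'b) \<Rightarrow> ('b, 'v) bimodule \<Rightarrow> ('c, 'v) bimodule" where
  "restrict_scalars \<theta> X = normed_space.extend (normed_space.truncate X)
     (bimodule.fields (\<lambda>c. lact X (\<theta> c)) (\<lambda>x c. ract X x (\<theta> c)))"

lemma restrict_scalars_simps:
  "carrier (restrict_scalars \<theta> X) = carrier X"
  "\<zero>\<^bsub>restrict_scalars \<theta> X\<^esub> = \<zero>\<^bsub>X\<^esub>"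
  "x \<oplus>\<^bsub>restrict_scalars \<theta> X\<^esub> y = x \<oplus>\<^bsub>X\<^esub> y"
  "z \<odot>\<^bsub>restrict_scalars \<theta> X\<^esub> x = z \<odot>\<^bsub>X\<^esub> x"
  "nrm (restrict_scalars \<theta> X) x = nrm X x"
  "lact (restrict_scalars \<theta> X) c x = lact X (\<theta> c) x"
  "ract (restrict_scalars \<theta> X) x c = ract X x (\<theta> c)"
  by (simp_all add: restrict_scalars_def normed_space.defs bimodule.defs)

lemma dual_restrict_scalars: "dual (restrict_scalars \<theta> X) = dual X"
  by (simp add: dual_def functionals_def restrict_scalars_simps)

lemma dual_module_minus: "f \<ominus>\<^bsub>dual_module X\<^esub> g = f \<ominus>\<^bsub>dual X\<^esub> g"
  by (simp add: dual_module_def normed_space.defs bimodule.defs a_minus_def a_inv_def m_inv_def)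

lemma banach_bimodule_restrict_scalars:
  assumes "banach_bimodule B X" and "banach_algebra C"
    and closed: "\<And>c. c \<in> carrier C \<Longrightarrow> \<theta> c \<in> carrier B"
    and add: "\<And>c d. \<lbrakk>c \<in> carrier C; d \<in> carrier C\<rbrakk> \<Longrightarrow> \<theta> (c \<oplus>\<^bsub>C\<^esub> d) = \<theta> c \<oplus>\<^bsub>B\<^esub> \<theta> d"
    and scale: "\<And>z c. c \<in> carrier C \<Longrightarrow> \<theta> (z \<odot>\<^bsub>C\<^esub> c) = z \<odot>\<^bsub>B\<^esub> \<theta> c"
    and mult: "\<And>c d. \<lbrakk>c \<in> carrier C; d \<in> carrier C\<rbrakk> \<Longrightarrow> \<theta> (c \<otimes>\<^bsub>C\<^esub> d) = \<theta> c \<otimes>\<^bsub>B\<^esub> \<theta> d"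
    and bound: "\<And>c. c \<in> carrier C \<Longrightarrow> nrm B (\<theta> c) \<le> nrm C c"
  shows "banach_bimodule C (restrict_scalars \<theta> X)"
proof -
  interpret banach_bimodule B X by fact
  interpret C: banach_algebra C by fact
  note simps = restrict_scalars_simps
  have X: "banach_space (restrict_scalars \<theta> X)"
    by (rule banach_space_isometric_copy[OF X.banach_space_axioms, where h = "\<lambda>x. x"])
      (auto simp: simps bij_betw_def)
  have le: "\<bar>K\<bar> * nrm B (\<theta> c) * nrm X x \<le> \<bar>K\<bar> * nrm C c * nrm X x"
    "K * nrm B (\<theta> c) * nrm X x \<le> \<bar>K\<bar> * nrm B (\<theta> c) * nrm X x"
    if "c \<in> carrier C" "x \<in> carrier X" for K c x
    using bound[OF that(1)] B.nrm_nonneg[OF closed[OF that(1)]] X.nrm_nonneg[OF that(2)]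
    by (auto intro!: mult_left_mono mult_right_mono)
  obtain K where K: "\<And>a x. \<lbrakk>a \<in> carrier B; x \<in> carrier X\<rbrakk>
      \<Longrightarrow> nrm X (lact X a x) \<le> K * nrm B a * nrm X x"
    using lact_bounded by blast
  have lact: "\<exists>K. \<forall>c\<in>carrier C. \<forall>x\<in>carrier X. nrm X (lact X (\<theta> c) x) \<le> K * nrm C c * nrm X x"
    using K[OF closed] le by (meson order_trans)
  obtain L where L: "\<And>a x. \<lbrakk>a \<in> carrier B; x \<in> carrier X\<rbrakk>
      \<Longrightarrow> nrm X (ract X x a) \<le> L * nrm B a * nrm X x"
    using ract_bounded by blast
  have ract: "\<exists>K. \<forall>c\<in>carrier C. \<forall>x\<in>carrier X. nrm X (ract X x (\<theta> c)) \<le> K * nrm C c * nrm X x"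
    using L[OF closed] le by (meson order_trans)
  show ?thesis
    by (intro banach_bimodule.intro banach_bimodule_axioms.intro C.banach_algebra_axioms X;
        unfold simps)
      (use lact ract in \<open>simp_all add: closed add scale mult lact_closed ract_closed lact_add_left
        lact_add_right lact_smult_left lact_smult_right ract_add_left ract_add_right
        ract_smult_left ract_smult_right lact_mult ract_mult lact_ract\<close>)
qed

section \<open>Weak* continuity on a reflexive algebra\<close>

text \<open>
  If every element of the bidual is evaluation at a point of \<open>A\<close>, the weak* topology of \<open>A**\<close>
  is the weak topology of \<open>A\<close>, and a bounded operator \<open>S\<close> from \<open>A\<close> into a dual space is weak-weak*
  continuous: for each \<open>x\<close> the map \<open>a \<mapsto> S a x\<close> is itself a functional \<open>\<phi>\<close> on \<open>A\<close>, and
  \<open>p \<mapsto> p \<phi>\<close> is a coordinate projection.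
\<close>

lemma weakstar_continuous_of_bounded:
  fixes A :: "('a, 'm) normed_space_scheme" (structure) and X :: "('v, 'n) normed_space_scheme"
  assumes "complex_normed_space A" "complex_normed_space X"
    and closed: "\<And>a. a \<in> carrier A \<Longrightarrow> S a \<in> carrier (dual X)"
    and add: "\<And>a b x. \<lbrakk>a \<in> carrier A; b \<in> carrier A; x \<in> carrier X\<rbrakk> \<Longrightarrow> S (a \<oplus> b) x = S a x + S b x"
    and scale: "\<And>c a x. \<lbrakk>a \<in> carrier A; x \<in> carrier X\<rbrakk> \<Longrightarrow> S (c \<odot> a) x = c * S a x"
    and bound: "\<And>a. a \<in> carrier A \<Longrightarrow> nrm (dual X) (S a) \<le> K * nrm A a"
    and \<theta>: "\<And>p. p \<in> carrier (dual (dual A)) \<Longrightarrow> \<theta> p \<in> carrier A \<and> embed A (\<theta> p) = p"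
  shows "continuous_map (weakstar (dual A)) (weakstar X) (\<lambda>p. S (\<theta> p))"
proof -
  interpret A: complex_normed_space A by fact
  interpret X: complex_normed_space X by fact
  have space: "topspace (weakstar (dual A)) = carrier (dual (dual A))"
    using dual_extensional by (fastforce simp: weakstar_def PiE_def)
  have "continuous_map (weakstar (dual A)) euclidean (\<lambda>p. S (\<theta> p) x)" if x: "x \<in> carrier X" for x
  proof -
    define \<phi> where "\<phi> = (\<lambda>a\<in>carrier A. S a x)"
    have \<phi>: "\<phi> \<in> carrier (dual A)"
    proof (rule dual_memI)
      fix a assume a: "a \<in> carrier A"
      have "cmod (S a x) \<le> nrm (dual X) (S a) * nrm X x" by (rule X.dual_bound[OF closed[OF a] x])
      also have "\<dots> \<le> (K * nrm A a) * nrm X x"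
        by (intro mult_right_mono bound a X.nrm_nonneg x)
      finally show "cmod (\<phi> a) \<le> (K * nrm X x) * nrm A a"
        using a by (simp add: \<phi>_def mult_ac)
    qed (use x in \<open>auto simp: \<phi>_def add scale A.scale_closed\<close>)
    have eval: "p \<phi> = S (\<theta> p) x" if "p \<in> carrier (dual (dual A))" for p
    proof -
      have "embed A (\<theta> p) \<phi> = \<phi> (\<theta> p)" using \<phi> by (simp add: embed_def)
      then show ?thesis using \<theta>[OF that] by (simp add: \<phi>_def)
    qed
    have "continuous_map (weakstar (dual A)) euclidean (\<lambda>p. p \<phi>)"
      unfolding weakstar_def
      by (intro continuous_map_from_subtopology continuous_map_product_projection \<phi>)
    then show ?thesis by (rule continuous_map_eq) (simp add: space eval)
  qed
  then show ?thesis
    unfolding weakstar_def[of X] continuous_map_in_subtopology continuous_map_componentwise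
    using \<theta> closed dual_extensional by (fastforce simp: space)
qed

section \<open>Connes amenability of a reflexive algebra\<close>

context banach_bimodule
begin

lemma dual_lact:
  assumes F: "F \<in> carrier (dual X)"
  shows "a \<in> carrier B \<Longrightarrow> lact (dual_module X) a F \<in> carrier (dual X)"
    and "\<exists>K. \<forall>a\<in>carrier B. nrm (dual X) (lact (dual_module X) a F) \<le> K * nrm B a"
proof -
  obtain K where K: "\<And>a x. \<lbrakk>a \<in> carrier B; x \<in> carrier X\<rbrakk>
      \<Longrightarrow> nrm X (ract X x a) \<le> K * nrm B a * nrm X x"
    using ract_bounded by blast
  define L where "L = nrm (dual X) F * \<bar>K\<bar>"
  have bound: "cmod (F (ract X x a)) \<le> (L * nrm B a) * nrm X x"
    if a: "a \<in> carrier B" and x: "x \<in> carrier X" for a x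
  proof -
    have "nrm X (ract X x a) \<le> \<bar>K\<bar> * nrm B a * nrm X x"
      using K[OF a x] mult_right_mono[OF mult_right_mono[OF abs_ge_self[of K] B.nrm_nonneg[OF a]] X.nrm_nonneg[OF x]]
      by linarith
    then have "nrm (dual X) F * nrm X (ract X x a) \<le> nrm (dual X) F * (\<bar>K\<bar> * nrm B a * nrm X x)"
      by (intro mult_left_mono X.dual_nrm_nonneg F)
    then show ?thesis
      using X.dual_bound[OF F ract_closed[OF a x]] by (simp add: L_def mult.assoc)
  qed
  show "lact (dual_module X) a F \<in> carrier (dual X)" if a: "a \<in> carrier B"
    using bound[OF a] a
    by (intro dual_memI[where K = "L * nrm B a"])
      (auto simp: dual_module_simps X.scale_closed ract_closed ract_add_left ract_smult_left
        dual_add[OF F] dual_scale[OF F])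
  have "nrm (dual X) (lact (dual_module X) a F) \<le> L * nrm B a" if a: "a \<in> carrier B" for a
    using bound[OF a] B.nrm_nonneg[OF a] X.dual_nrm_nonneg[OF F]
    by (intro X.dual_nrm_leI) (auto simp: dual_module_simps L_def)
  then show "\<exists>K. \<forall>a\<in>carrier B. nrm (dual X) (lact (dual_module X) a F) \<le> K * nrm B a" by blast
qed

lemma dual_ract:
  assumes F: "F \<in> carrier (dual X)"
  shows "a \<in> carrier B \<Longrightarrow> ract (dual_module X) F a \<in> carrier (dual X)"
    and "\<exists>K. \<forall>a\<in>carrier B. nrm (dual X) (ract (dual_module X) F a) \<le> K * nrm B a"
proof -
  obtain K where K: "\<And>a x. \<lbrakk>a \<in> carrier B; x \<in> carrier X\<rbrakk>
      \<Longrightarrow> nrm X (lact X a x) \<le> K * nrm B a * nrm X x"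
    using lact_bounded by blast
  define L where "L = nrm (dual X) F * \<bar>K\<bar>"
  have bound: "cmod (F (lact X a x)) \<le> (L * nrm B a) * nrm X x"
    if a: "a \<in> carrier B" and x: "x \<in> carrier X" for a x
  proof -
    have "nrm X (lact X a x) \<le> \<bar>K\<bar> * nrm B a * nrm X x"
      using K[OF a x] mult_right_mono[OF mult_right_mono[OF abs_ge_self[of K] B.nrm_nonneg[OF a]] X.nrm_nonneg[OF x]]
      by linarith
    then have "nrm (dual X) F * nrm X (lact X a x) \<le> nrm (dual X) F * (\<bar>K\<bar> * nrm B a * nrm X x)"
      by (intro mult_left_mono X.dual_nrm_nonneg F)
    then show ?thesis
      using X.dual_bound[OF F lact_closed[OF a x]] by (simp add: L_def mult.assoc)
  qed
  show "ract (dual_module X) F a \<in> carrier (dual X)" if a: "a \<in> carrier B"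
    using bound[OF a] a
    by (intro dual_memI[where K = "L * nrm B a"])
      (auto simp: dual_module_simps X.scale_closed lact_closed lact_add_right lact_smult_right
        dual_add[OF F] dual_scale[OF F])
  have "nrm (dual X) (ract (dual_module X) F a) \<le> L * nrm B a" if a: "a \<in> carrier B" for a
    using bound[OF a] B.nrm_nonneg[OF a] X.dual_nrm_nonneg[OF F]
    by (intro X.dual_nrm_leI) (auto simp: dual_module_simps L_def)
  then show "\<exists>K. \<forall>a\<in>carrier B. nrm (dual X) (ract (dual_module X) F a) \<le> K * nrm B a" by blast
qed

end

lemma (in banach_algebra) embed_homomorphism:
  assumes a: "a \<in> carrier A" and b: "b \<in> carrier A"
  shows "embed A (a \<oplus> b) = embed A a \<oplus>\<^bsub>bidual A\<^esub> embed A b"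
    and "embed A (c \<odot> a) = c \<odot>\<^bsub>bidual A\<^esub> embed A a"
    and "embed A (a \<otimes> b) = embed A a \<otimes>\<^bsub>bidual A\<^esub> embed A b"
proof -
  show "embed A (a \<oplus> b) = embed A a \<oplus>\<^bsub>bidual A\<^esub> embed A b"
    using a b by (auto simp: embed_def bidual_simps dual_simps dual_add)
  show "embed A (c \<odot> a) = c \<odot>\<^bsub>bidual A\<^esub> embed A a"
    using a by (auto simp: embed_def bidual_simps dual_simps dual_scale)
  show "embed A (a \<otimes> b) = embed A a \<otimes>\<^bsub>bidual A\<^esub> embed A b"
  proof (rule extensionalityI)
    show "embed A (a \<otimes> b) f = (embed A a \<otimes>\<^bsub>bidual A\<^esub> embed A b) f" if f: "f \<in> carrier (dual A)" for f
      using arens1_embed_left[OF a embed_bidual[OF b] f] translate_left_functional[OF f a] b f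
      by (simp add: bidual_simps(6)) (simp add: embed_def)
  qed (simp_all add: embed_def bidual_simps arens1_def)
qed

lemma (in banach_algebra) embed_inj: "inj_on (embed A) (carrier A)"
proof (rule inj_onI)
  fix a b assume a: "a \<in> carrier A" and b: "b \<in> carrier A" and eq: "embed A a = embed A b"
  have "embed A (a \<ominus> b) f = 0" if "f \<in> carrier (dual A)" for f
    using fun_cong[OF eq, of f] that a b by (simp add: embed_def dual_diff)
  then have "nrm (dual (dual A)) (embed A (a \<ominus> b)) \<le> 0"
    by (intro dual_nrm_le complex_normed_space_dual) auto
  then have "nrm A (a \<ominus> b) \<le> 0"
    using nrm_le_nrm_embed[of "a \<ominus> b"] a b by simp
  then have "a \<ominus> b = \<zero>"
    using nrm_nonneg[of "a \<ominus> b"] nrm_eq_0_iff[of "a \<ominus> b"] a b by simp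
  then show "a = b"
    using a b M.minus_equality[of a "\<ominus> b"] by (simp add: a_minus_def)
qed

text \<open>
  When \<open>A = A**\<close>, every Banach \<open>A\<close>-module becomes an \<open>A**\<close>-module through the inverse \<open>\<theta>\<close> of the
  embedding. Orbit maps \<open>a \<mapsto> a.F\<close>, \<open>a \<mapsto> F.a\<close> and bounded derivations are bounded operators into a
  dual space, so the dual module is normal and the derivation is weak* continuous; Connes
  amenability then supplies the implementing element.
\<close>

lemma (in banach_algebra) amenable_if_bidual_connes_amenable:
  assumes surj: "embed A ` carrier A = carrier (bidual A)"
    and connes: "connes_amenable TYPE('u) (dual A) (bidual A)"
  shows "amenable TYPE('u) A"
  unfolding amenable_def
proof (intro allI impI)
  fix X :: "('a, 'u) bimodule" and D
  assume X: "banach_bimodule A X" and deriv: "derivation A (dual_module X) D"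
    and bounded: "bounded_map A (dual_module X) D"
  interpret banach_bimodule A X by (rule X)
  define \<theta> where "\<theta> = inv_into (carrier A) (embed A)"
  have \<theta>: "\<theta> p \<in> carrier A \<and> embed A (\<theta> p) = p" if "p \<in> carrier (bidual A)" for p
    using that surj by (auto simp: \<theta>_def inv_into_into f_inv_into_f)
  have \<theta>_embed: "\<theta> (embed A a) = a" if "a \<in> carrier A" for a
    using that embed_inj by (simp add: \<theta>_def)
  have \<theta>_add: "\<theta> (p \<oplus>\<^bsub>bidual A\<^esub> q) = \<theta> p \<oplus> \<theta> q"
    and \<theta>_mult: "\<theta> (p \<otimes>\<^bsub>bidual A\<^esub> q) = \<theta> p \<otimes> \<theta> q"
    and \<theta>_scale: "\<theta> (c \<odot>\<^bsub>bidual A\<^esub> p) = c \<odot> \<theta> p"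
    if "p \<in> carrier (bidual A)" "q \<in> carrier (bidual A)" for p q c
    using \<theta>[OF that(1)] \<theta>[OF that(2)] embed_homomorphism[of "\<theta> p" "\<theta> q"]
      \<theta>_embed[of "\<theta> p \<oplus> \<theta> q"] \<theta>_embed[of "\<theta> p \<otimes> \<theta> q"] \<theta>_embed[of "c \<odot> \<theta> p"]
    by (simp_all add: mult_closed scale_closed)
  have \<theta>_bound: "nrm A (\<theta> p) \<le> nrm (bidual A) p" if "p \<in> carrier (bidual A)" for p
    using nrm_le_nrm_embed[of "\<theta> p"] \<theta>[OF that] by (simp add: bidual_simps)
  define X' where "X' = restrict_scalars \<theta> X"
  have X': "banach_bimodule (bidual A) X'"
    unfolding X'_def using \<theta> \<theta>_add \<theta>_mult \<theta>_scale \<theta>_bound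
    by (intro banach_bimodule_restrict_scalars[OF X banach_algebra_bidual]) auto
  have carrier_X': "carrier (dual_module X') = carrier (dual X)"
    by (simp add: X'_def dual_module_simps dual_restrict_scalars)
  have add_X': "f \<oplus>\<^bsub>dual_module X'\<^esub> g = f \<oplus>\<^bsub>dual_module X\<^esub> g"
    and scale_X': "c \<odot>\<^bsub>dual_module X'\<^esub> f = c \<odot>\<^bsub>dual_module X\<^esub> f"
    and minus_X': "f \<ominus>\<^bsub>dual_module X'\<^esub> g = f \<ominus>\<^bsub>dual_module X\<^esub> g"
    and lact_X': "lact (dual_module X') p f = lact (dual_module X) (\<theta> p) f"
    and ract_X': "ract (dual_module X') f p = ract (dual_module X) f (\<theta> p)" for f g c p
    by (simp_all add: X'_def dual_module_simps dual_module_minus dual_restrict_scalars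
        restrict_scalars_simps)
  have weakstar_X': "weakstar X' = weakstar X"
    by (simp add: X'_def weakstar_def dual_restrict_scalars restrict_scalars_simps)
  note continuous = weakstar_continuous_of_bounded[OF complex_normed_space_axioms
      X.complex_normed_space_axioms, where \<theta> = \<theta>, OF _ _ _ _ \<theta>[unfolded bidual_simps]]
  have "normal_dual_module (dual A) (bidual A) X'"
    unfolding normal_dual_module_def carrier_X' weakstar_X' lact_X' ract_X'
  proof (intro conjI ballI X')
    fix F assume F: "F \<in> carrier (dual X)"
    obtain K where K: "\<forall>a\<in>carrier A. nrm (dual X) (lact (dual_module X) a F) \<le> K * nrm A a"
      using dual_lact(2)[OF F] by blast
    show "continuous_map (weakstar (dual A)) (weakstar X) (\<lambda>p. lact (dual_module X) (\<theta> p) F)"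
      by (intro continuous[OF dual_lact(1)[OF F] _ _ bspec[OF K]])
        (auto simp: dual_module_simps ract_add_right ract_smult_right ract_closed
          dual_add[OF F] dual_scale[OF F])
    obtain K where K: "\<forall>a\<in>carrier A. nrm (dual X) (ract (dual_module X) F a) \<le> K * nrm A a"
      using dual_ract(2)[OF F] by blast
    show "continuous_map (weakstar (dual A)) (weakstar X) (\<lambda>p. ract (dual_module X) F (\<theta> p))"
      by (intro continuous[OF dual_ract(1)[OF F] _ _ bspec[OF K]])
        (auto simp: dual_module_simps lact_add_left lact_smult_left lact_closed
          dual_add[OF F] dual_scale[OF F])
  qed
  moreover have "derivation (bidual A) (dual_module X') (\<lambda>p. D (\<theta> p))"
    using deriv \<theta> unfolding derivation_def carrier_X' add_X' scale_X' lact_X' ract_X'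
    by (auto simp: \<theta>_add \<theta>_mult \<theta>_scale dual_module_simps(1) Pi_iff)
  moreover have "continuous_map (weakstar (dual A)) (weakstar X') (\<lambda>p. D (\<theta> p))"
  proof -
    obtain K where K: "\<forall>a\<in>carrier A. nrm (dual X) (D a) \<le> K * nrm A a"
      using bounded by (auto simp: bounded_map_def dual_module_simps)
    show ?thesis
      unfolding weakstar_X' using deriv
      by (intro continuous[OF _ _ _ bspec[OF K]])
        (auto simp: derivation_def dual_module_simps(1,3,4) dual_simps)
  qed
  ultimately have "inner_derivation (bidual A) (dual_module X') (\<lambda>p. D (\<theta> p))"
    using connes unfolding connes_amenable_def by blast
  then obtain y where y: "y \<in> carrier (dual_module X')" and inner: "\<And>p. p \<in> carrier (bidual A)
      \<Longrightarrow> D (\<theta> p) = lact (dual_module X) (\<theta> p) y \<ominus>\<^bsub>dual_module X\<^esub> ract (dual_module X) y (\<theta> p)"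
    unfolding inner_derivation_def minus_X' lact_X' ract_X' by blast
  have y': "y \<in> carrier (dual_module X)"
    using y carrier_X' dual_module_simps(1)[of X] by blast
  have "D a = lact (dual_module X) a y \<ominus>\<^bsub>dual_module X\<^esub> ract (dual_module X) y a"
    if "a \<in> carrier A" for a
    using inner[OF embed_bidual[OF that]] by (simp add: \<theta>_embed[OF that])
  then show "inner_derivation A (dual_module X) D"
    using y' unfolding inner_derivation_def by (intro bexI[of _ y] ballI)
qed

theorem theorem1p3:
  fixes A :: "'a normed_space"
  assumes "banach_algebra A"
    and "arens_regular A"
    and "has_bounded_approximate_identity A"
    and "right_ideal_of_bidual A"
    and "\<forall>X :: (('a \<Rightarrow> complex) \<Rightarrow> complex, ('a, 'x) universe) bimodule.
           banach_bimodule (bidual A) X \<and> neo_unital (bidual A) X \<longrightarrow> dual_factors_on_left A X"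
    and "connes_amenable TYPE(('a, 'x) universe) (dual A) (bidual A)"
  shows "amenable TYPE(('a, 'x) universe) A"
proof -
  interpret banach_algebra A by fact
  \<comment> \<open>Coding functionals by indicator functions places the dual of \<open>A\<close> in the type of modules.\<close>
  define h :: "('a \<Rightarrow> complex) \<Rightarrow> ('a, 'x) universe"
    where "h f = Inl (\<lambda>g. if g = f then 1 else 0)" for f
  have "inj h"
  proof (rule injI)
    fix f g :: "'a \<Rightarrow> complex" assume "h f = h g"
    then have eq: "(\<lambda>k. if k = f then 1 else (0::complex)) = (\<lambda>k. if k = g then 1 else 0)"
      by (simp only: h_def sum.inject)
    show "f = g" using fun_cong[OF eq, of f] by (simp split: if_splits)
  qed
  then have "embed A ` carrier A = carrier (bidual A)"
    using assms(2-5) by (intro embed_surj) auto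
  then show ?thesis using assms(6) by (rule amenable_if_bidual_connes_amenable)
qed

end
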